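(* Let $n\geq1$, $G=SU(n+2)$, $H=S(U(n)\times U(1)\times U(1))$ and $F_n=G/H$. Up to equivalence and complex conjugation, $F_n$ admits at most three $G$-invariant almost complex structures $I$, $J$ and $\hat J$. Their roots are $$I:\quad y_i+\tfrac{n+1}{n}x-y,\quad y_i+\tfrac1n x+y,\quad -x+2y,\qquad 1\leq i\leq n,$$ $$J:\quad y_i+\tfrac{n+1}{n}x-y,\quad -y_i-\tfrac1n x-y,\quad x-2y,\qquad 1\leq i\leq n,$$ $$\hat J:\quad y_i+\tfrac{n+1}{n}x-y,\quad -y_i-\tfrac1n x-y,\quad -x+2y,\qquad 1\leq i\leq n.$$ The structures $I$ and $J$ are integrable, and $\hat J$ is not.
   Context: $H$ is embedded in $G$ block-diagonally with $U(n)$ acting on the first $n$ coordinates and the two $U(1)$ factors on the last two. Let $\mathfrak t$ be the maximal Abelian subalgebra of diagonal matrices, with canonical linear coordinates $x_1,\dots,x_{n+2}$, $x_1+\dots+x_{n+2}=0$. The linear forms $x,y,y_1,\dots,y_n$ on $\mathfrak t$, with $y_1+\dots+y_n=0$, are determined by $x_i=y_i+\frac1n x$ for $1\leq i\leq n$, $x_{n+1}=-x+y$, $x_{n+2}=-y$. The roots of $\mathfrak g$ are $\pm(x_i-x_j)$; the complementary roots $\pm\beta_j$ are those that are not roots of $\mathfrak h$, and $T_{eH}(G/H)=\bigoplus_j\mathfrak g_{\pm\beta_j}$, where each $\mathfrak g_{\pm\beta_j}$ is a real $2$-dimensional space. A $G$-invariant almost complex structure on $G/H$ is the same as a complex structure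 on $T_{eH}(G/H)$ invariant under the isotropy representation of $H$; it preserves each $\mathfrak g_{\pm\beta_j}$. The roots of the invariant almost complex structure are the forms $\varepsilon_j\beta_j$, $\varepsilon_j\in\{\pm1\}$, where the sign is chosen so that the adjoint representation of the maximal torus on $\mathfrak g_{\pm\beta_j}$, viewed as a complex line via the almost complex structure, has weight $\varepsilon_j\beta_j$. Complex conjugation replaces an almost complex structure by its negative. Two invariant almost complex structures are equivalent if one is carried to the other by an automorphism of the homogeneous space induced by an automorphism of $G$ preserving $H$. *)

theory Defs
  imports "HOL-Analysis.Analysis"
begin

text \<open>Smooth maps. On an open subset \<open>S\<close> of a Euclidean space, \<open>smooth_on S\<close> is the usual notion of
  being infinitely differentiable; on a subset such as an embedded submanifold, a map is smooth
  if it extends locally to a smooth map on an open set.\<close>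

primrec Ck_on :: "nat \<Rightarrow> 'a::euclidean_space set \<Rightarrow> ('a \<Rightarrow> 'b::euclidean_space) \<Rightarrow> bool" where
  "Ck_on 0 S f \<longleftrightarrow> continuous_on S f"
| "Ck_on (Suc k) S f \<longleftrightarrow>
     (\<exists>f'. (\<forall>x\<in>S. (f has_derivative f' x) (at x)) \<and> (\<forall>v. Ck_on k S (\<lambda>x. f' x v)))"

definition smooth_on :: "'a::euclidean_space set \<Rightarrow> ('a \<Rightarrow> 'b::euclidean_space) \<Rightarrow> bool" where
  "smooth_on S f \<longleftrightarrow> (\<forall>k. Ck_on k S f)"

definition smooth_map_on :: "'a::euclidean_space set \<Rightarrow> ('a \<Rightarrow> 'b::euclidean_space) \<Rightarrow> bool" where
  "smooth_map_on M f \<longleftrightarrow>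
     (\<forall>x\<in>M. \<exists>U F. open U \<and> x \<in> U \<and> smooth_on U F \<and> (\<forall>y\<in>M \<inter> U. F y = f y))"

text \<open>The coordinates of \<open>\<complex>\<^sup>n\<^sup>+\<^sup>2\<close> are indexed by the type \<open>'n + bool\<close> with
  \<open>n = CARD('n)\<close>: the indices \<open>Inl i\<close> are the first \<open>n\<close> ones, \<open>Inr False\<close> is \<open>n+1\<close> and
  \<open>Inr True\<close> is \<open>n+2\<close>.\<close>

type_synonym 'n cmat = "complex ^ ('n + bool) ^ ('n + bool)"

definition dagger :: "('n::finite) cmat \<Rightarrow> 'n cmat" where
  "dagger A = (\<chi> i j. cnj (A $ j $ i))"

definition bracket :: "('n::finite) cmat \<Rightarrow> 'n cmat \<Rightarrow> 'n cmat" where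
  "bracket A B = A ** B - B ** A"

definition same_block :: "'n + bool \<Rightarrow> 'n + bool \<Rightarrow> bool" where
  "same_block i j \<longleftrightarrow> i = j \<or> (isl i \<and> isl j)"

definition SU :: "('n::finite) cmat set" where
  "SU = {g. g ** dagger g = mat 1 \<and> det g = 1}"

text \<open>\<open>H = S(U(n) \<times> U(1) \<times> U(1))\<close>\<close>

definition SUH :: "('n::finite) cmat set" where
  "SUH = {g \<in> SU. \<forall>i j. \<not> same_block i j \<longrightarrow> g $ i $ j = 0}"

definition su :: "('n::finite) cmat set" where
  "su = {X. dagger X = - X \<and> trace X = 0}"

text \<open>The tangent space \<open>T\<^sub>e\<^sub>H(G/H) = \<gg>/\<hh>\<close> is identified with the \<open>Ad(H)\<close>-invariant complement
  \<open>mspace\<close> of \<open>\<hh>\<close> in \<open>\<gg> = su\<close>, so that \<open>mproj\<close>, which has kernel \<open>\<hh>\<close> on \<open>su\<close>, is the quotient map.\<close>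

definition mproj :: "('n::finite) cmat \<Rightarrow> 'n cmat" where
  "mproj X = (\<chi> i j. if same_block i j then 0 else X $ i $ j)"

definition mspace :: "('n::finite) cmat set" where
  "mspace = {X \<in> su. mproj X = X}"

definition torus_algebra :: "('n::finite) cmat set" where
  "torus_algebra = {h \<in> su. \<forall>i j. i \<noteq> j \<longrightarrow> h $ i $ j = 0}"

text \<open>The element of \<open>\<tt>\<close> with coordinates \<open>x\<^sub>k\<close> is the diagonal matrix with entries \<open>\<i> x\<^sub>k\<close>.\<close>

definition xcoord :: "'n + bool \<Rightarrow> ('n::finite) cmat \<Rightarrow> real" where
  "xcoord k h = Im (h $ k $ k)"

text \<open>Linear forms on \<open>\<tt>\<close> are functions restricted to \<open>torus_algebra\<close>, so that forms agreeing on
  \<open>\<tt>\<close> are equal.\<close>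

definition roots_g :: "(('n::finite) cmat \<Rightarrow> real) set" where
  "roots_g = {(\<lambda>h\<in>torus_algebra. xcoord i h - xcoord j h) | i j. i \<noteq> j}"

definition roots_h :: "(('n::finite) cmat \<Rightarrow> real) set" where
  "roots_h = {(\<lambda>h\<in>torus_algebra. xcoord i h - xcoord j h) | i j. i \<noteq> j \<and> same_block i j}"

definition complementary_roots :: "(('n::finite) cmat \<Rightarrow> real) set" where
  "complementary_roots = roots_g - roots_h"

text \<open>For a root \<open>\<beta>\<close>, this is the real two-dimensional space \<open>\<gg>\<^sub>\<plusminus>\<^sub>\<beta>\<close>.\<close>

definition root_space :: "(('n::finite) cmat \<Rightarrow> real) \<Rightarrow> 'n cmat set" where
  "root_space \<beta> =
     {X \<in> su. \<forall>h\<in>torus_algebra. bracket h (bracket h X) = - ((\<beta> h)\<^sup>2 *\<^sub>R X)}"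

text \<open>A \<open>G\<close>-invariant almost complex structure on \<open>G/H\<close>, given by its value at the base point; only
  the values of \<open>K\<close> on \<open>mspace\<close> matter. The isotropy representation is \<open>X \<mapsto> k X k\<^sup>-\<^sup>1\<close>, where
  \<open>k\<^sup>-\<^sup>1 = dagger k\<close> for \<open>k \<in> H\<close>.\<close>

definition invariant_acs :: "(('n::finite) cmat \<Rightarrow> 'n cmat) \<Rightarrow> bool" where
  "invariant_acs K \<longleftrightarrow>
     (\<forall>X\<in>mspace. K X \<in> mspace) \<and>
     (\<forall>X\<in>mspace. \<forall>Y\<in>mspace. K (X + Y) = K X + K Y) \<and>
     (\<forall>c::real. \<forall>X\<in>mspace. K (c *\<^sub>R X) = c *\<^sub>R K X) \<and>
     (\<forall>X\<in>mspace. K (K X) = - X) \<and>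
     (\<forall>k\<in>SUH. \<forall>X\<in>mspace. K (k ** X ** dagger k) = k ** K X ** dagger k)"

text \<open>A weight \<open>\<alpha>\<close> of the torus on a complex line means that \<open>h \<in> \<tt>\<close> acts as \<open>\<i> \<alpha>(h)\<close>; here the
  imaginary unit is \<open>K\<close>.\<close>

definition acs_roots :: "(('n::finite) cmat \<Rightarrow> 'n cmat) \<Rightarrow> ('n cmat \<Rightarrow> real) set" where
  "acs_roots K =
     {\<alpha> \<in> complementary_roots.
        \<forall>h\<in>torus_algebra. \<forall>X\<in>root_space \<alpha>. bracket h X = \<alpha> h *\<^sub>R K X}"

definition conjugate_acs :: "(('n::finite) cmat \<Rightarrow> 'n cmat) \<Rightarrow> 'n cmat \<Rightarrow> 'n cmat" where
  "conjugate_acs K = (\<lambda>X. - K X)"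

definition pair_automorphism :: "(('n::finite) cmat \<Rightarrow> 'n cmat) \<Rightarrow> bool" where
  "pair_automorphism \<phi> \<longleftrightarrow>
     bij_betw \<phi> SU SU \<and> (\<forall>g\<in>SU. \<forall>g'\<in>SU. \<phi> (g ** g') = \<phi> g ** \<phi> g') \<and>
     smooth_map_on SU \<phi> \<and> \<phi> ` SUH = SUH"

text \<open>The derivative \<open>D\<close> within \<open>SU\<close> is determined on the tangent space \<open>su\<close>, and \<open>mproj \<circ> D\<close>
  restricted to \<open>mspace\<close> is the map induced on \<open>\<gg>/\<hh>\<close>.\<close>

definition equivalent_acs ::
    "(('n::finite) cmat \<Rightarrow> 'n cmat) \<Rightarrow> ('n cmat \<Rightarrow> 'n cmat) \<Rightarrow> bool" where
  "equivalent_acs K L \<longleftrightarrow>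
     (\<exists>\<phi> D. pair_automorphism \<phi> \<and> (\<phi> has_derivative D) (at (mat 1) within SU) \<and>
        (\<forall>X\<in>mspace. mproj (D (K X)) = L (mproj (D X))))"

text \<open>A holomorphic chart of \<open>G/H\<close> with values in \<open>\<complex>\<^sup>2\<^sup>n\<^sup>+\<^sup>1\<close>, where the domain is given by its
  preimage \<open>W\<close> in \<open>G\<close> and the chart by its lift \<open>F\<close> to \<open>W\<close>. The tangent space of \<open>G/H\<close> at \<open>gH\<close>
  consists of the classes of the vectors \<open>g X\<close> with \<open>X \<in> mspace\<close>, and the invariant almost complex
  structure maps the class of \<open>g X\<close> to that of \<open>g (K X)\<close>.\<close>

definition holomorphic_chart ::
    "(('n::finite) cmat \<Rightarrow> 'n cmat) \<Rightarrow> 'n cmat set \<Rightarrow>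
     ('n cmat \<Rightarrow> complex ^ ('n + 'n + unit)) \<Rightarrow> bool" where
  "holomorphic_chart K W F \<longleftrightarrow>
     openin (top_of_set SU) W \<and> (\<forall>g\<in>W. \<forall>k\<in>SUH. g ** k \<in> W) \<and>
     smooth_map_on W F \<and>
     (\<forall>g\<in>W. \<forall>g'\<in>W. F g = F g' \<longleftrightarrow> (\<exists>k\<in>SUH. g' = g ** k)) \<and>
     (\<forall>g\<in>W. \<exists>D. (F has_derivative D) (at g within W) \<and>
        (\<forall>X\<in>mspace. D (g ** K X) = \<i> *s D (g ** X)) \<and>
        (\<forall>X\<in>mspace. D (g ** X) = 0 \<longrightarrow> X = 0))"

definition integrable_acs :: "(('n::finite) cmat \<Rightarrow> 'n cmat) \<Rightarrow> bool" where
  "integrable_acs K \<longleftrightarrow> (\<forall>g\<in>SU. \<exists>W F. g \<in> W \<and> holomorphic_chart K W F)"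

end

theory Submission
  imports Defs
begin

text \<open>An invariant almost complex structure commutes with the maximal torus, so it acts on each root
  space as \<open>\<plusminus>\<i>\<close>. Conjugation by \<open>U(n)\<close> permutes the first \<open>n\<close> indices up to sign, so only three signs
  are free, one for each pair of the blocks \<open>A = {1..n}\<close>, \<open>B = {n+1}\<close>, \<open>C = {n+2}\<close>. Complex conjugation
  flips all of them and exchanging \<open>B\<close> and \<open>C\<close> sends \<open>(a, b, c)\<close> to \<open>(b, a, -c)\<close>, which leaves
  \<open>(+,+,+)\<close>, \<open>(+,-,-)\<close> and \<open>(+,-,+)\<close>. The first two orient the blocks transitively: \<open>G/H\<close> is then a flag
  manifold of \<open>GL(n+2)\<close> with explicit rational coordinates near the identity, and left translation
  carries them everywhere. The last one is cyclic, and its Nijenhuis tensor does not vanish.\<close>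

subsection \<open>Smooth maps\<close>

text \<open>Integrability is defined by holomorphic charts, so neither direction can quote the
  Nijenhuis tensor: charts have to be exhibited for two structures and excluded for the third by
  differentiating a hypothetical chart twice. The obstacle is that a chart lives on a subset of
  \<open>SU\<close>, where only derivatives along \<open>g ** X\<close> with \<open>X\<close> in
  \<open>su\<close> are determined. Smoothness supplies an extension to an open set of matrices;
  second derivatives are symmetric there, and what is known about the chart is carried over to the
  extension along curves inside \<open>SU\<close>. The explicit charts are read off from columns.
  Right multiplication by \<open>SUH\<close> rescales columns B and C and mixes the others among
  themselves, while moving \<open>u\<close> along \<open>u ** X\<close> changes column q by the
  combination of the columns of \<open>u\<close> whose coefficients form column q of
  \<open>X\<close>. So the signs in one column of \<open>block_sign\<close> decide how that column
  varies: holomorphically if they are 1, antiholomorphically if they are -1, and if they are mixed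
  only modulo another column.\<close>

lemma Ck_on_Suc_imp: "Ck_on (Suc k) S f \<Longrightarrow> Ck_on k S f"
proof (induction k arbitrary: f)
  case 0
  then show ?case
    using has_derivative_continuous by (fastforce intro: continuous_at_imp_continuous_on)
next
  case (Suc k)
  then show ?case by (metis Ck_on.simps(2))
qed

lemma Ck_on_const: "Ck_on k S (\<lambda>_. c)"
proof (induction k arbitrary: c)
  case (Suc k)
  have "((\<lambda>_. c) has_derivative (\<lambda>_. 0)) (at x)" for x by simp
  with Suc show ?case by (auto intro!: exI[of _ "\<lambda>_ _. 0"])
qed auto

lemma Ck_on_bounded_linear:
  assumes "bounded_linear f"
  shows "Ck_on k S f"
proof (cases k)
  case 0
  then show ?thesis using assms by (simp add: linear_continuous_on)
next
  case (Suc m)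
  have "\<forall>x\<in>S. (f has_derivative f) (at x)"
    using assms bounded_linear_imp_has_derivative by blast
  then show ?thesis unfolding Suc Ck_on.simps
    by (intro exI[of _ "\<lambda>_. f"]) (simp add: Ck_on_const)
qed

lemma Ck_on_add:
  "Ck_on k S f \<Longrightarrow> Ck_on k S g \<Longrightarrow> Ck_on k S (\<lambda>x. f x + g x)"
proof (induction k arbitrary: f g)
  case (Suc k)
  obtain f' where f': "\<forall>x\<in>S. (f has_derivative f' x) (at x)" "\<forall>v. Ck_on k S (\<lambda>x. f' x v)"
    using Suc.prems(1) by auto
  obtain g' where g': "\<forall>x\<in>S. (g has_derivative g' x) (at x)" "\<forall>v. Ck_on k S (\<lambda>x. g' x v)"
    using Suc.prems(2) by auto
  show ?case
    unfolding Ck_on.simps using f' g'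
    by (intro exI[of _ "\<lambda>x v. f' x v + g' x v"]) (auto intro!: has_derivative_add Suc.IH)
qed (auto intro: continuous_intros)

lemma Ck_on_mult:
  fixes f g :: "'a::euclidean_space \<Rightarrow> complex"
  shows "Ck_on k S f \<Longrightarrow> Ck_on k S g \<Longrightarrow> Ck_on k S (\<lambda>x. f x * g x)"
proof (induction k arbitrary: f g)
  case (Suc k)
  obtain f' where f': "\<forall>x\<in>S. (f has_derivative f' x) (at x)" "\<forall>v. Ck_on k S (\<lambda>x. f' x v)"
    using Suc.prems(1) by auto
  obtain g' where g': "\<forall>x\<in>S. (g has_derivative g' x) (at x)" "\<forall>v. Ck_on k S (\<lambda>x. g' x v)"
    using Suc.prems(2) by auto
  have "Ck_on k S (\<lambda>x. f x * g' x v + f' x v * g x)" for v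
    using f' g' Suc.prems by (intro Ck_on_add Suc.IH) (auto dest: Ck_on_Suc_imp simp del: Ck_on.simps)
  then show ?case
    unfolding Ck_on.simps using f' g'
    by (intro exI[of _ "\<lambda>x v. f x * g' x v + f' x v * g x"]) (auto intro!: has_derivative_mult)
qed (auto intro: continuous_intros)

lemma Ck_on_inverse:
  fixes f :: "'a::euclidean_space \<Rightarrow> complex"
  assumes "\<And>x. x \<in> S \<Longrightarrow> f x \<noteq> 0"
  shows "Ck_on k S f \<Longrightarrow> Ck_on k S (\<lambda>x. inverse (f x))"
proof (induction k)
  case 0
  then show ?case using assms by (auto intro!: continuous_intros)
next
  case (Suc k)
  obtain f' where f': "\<forall>x\<in>S. (f has_derivative f' x) (at x)" "\<forall>v. Ck_on k S (\<lambda>x. f' x v)"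
    using Suc.prems(1) by auto
  have 1: "Ck_on k S (\<lambda>x. inverse (f x))"
    using Suc Ck_on_Suc_imp by blast
  have "Ck_on k S (\<lambda>x. (-1) * (inverse (f x) * f' x v * inverse (f x)))" for v
    using f' 1 by (intro Ck_on_mult Ck_on_const) auto
  then show ?case
    unfolding Ck_on.simps using f' assms
    by (intro exI[of _ "\<lambda>x v. - (inverse (f x) * f' x v * inverse (f x))"])
       (auto intro!: has_derivative_inverse)
qed

lemma has_derivative_vec:
  fixes f :: "'a::real_normed_vector \<Rightarrow> 'b::euclidean_space ^ 'm"
  assumes "\<And>i. ((\<lambda>x. f x $ i) has_derivative (\<lambda>v. f' v $ i)) (at x within S)"
  shows "(f has_derivative f') (at x within S)"
  using assms
  by (auto simp: has_derivative_componentwise_within[of f] Basis_vec_def inner_axis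
      intro!: has_derivative_inner_left)

lemma Ck_on_vec:
  fixes f :: "'a::euclidean_space \<Rightarrow> 'b::euclidean_space ^ 'm"
  shows "(\<And>i. Ck_on k S (\<lambda>x. f x $ i)) \<Longrightarrow> Ck_on k S f"
proof (induction k arbitrary: f)
  case 0
  have "continuous_on S (\<lambda>x. \<chi> i. f x $ i)"
    using 0 by (intro continuous_on_vec_lambda) auto
  then show ?case by simp
next
  case (Suc k)
  have "\<forall>i. \<exists>f'. (\<forall>x\<in>S. ((\<lambda>x. f x $ i) has_derivative f' x) (at x)) \<and> (\<forall>v. Ck_on k S (\<lambda>x. f' x v))"
    using Suc.prems by simp
  then obtain f' where f': "\<And>i x. x \<in> S \<Longrightarrow> ((\<lambda>x. f x $ i) has_derivative f' i x) (at x)"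
    "\<And>i v. Ck_on k S (\<lambda>x. f' i x v)"
    by metis
  have "Ck_on k S (\<lambda>x. \<chi> i. f' i x v)" for v
    using f'(2) by (intro Suc.IH) auto
  then show ?case
    unfolding Ck_on.simps using f'(1)
    by (intro exI[of _ "\<lambda>x v. \<chi> i. f' i x v"]) (auto intro!: has_derivative_vec)
qed

text \<open>The chain rule is needed only for linear inner maps: charts are moved by left
  translation, which is linear on the ambient matrix space. The inner derivative is then the
  constant \<open>L\<close>, so the induction on \<open>k\<close> closes without products.\<close>

lemma Ck_on_compose_linear:
  assumes L: "bounded_linear L"
  shows "Ck_on k S f \<Longrightarrow> Ck_on k (L -` S) (\<lambda>x. f (L x))"
proof (induction k arbitrary: f)
  case 0
  have "continuous_on (L -` S) L" using L by (rule linear_continuous_on)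
  moreover have "continuous_on (L ` (L -` S)) f"
    using 0 by (auto intro: continuous_on_subset)
  ultimately show ?case by (auto dest: continuous_on_compose simp: o_def)
next
  case (Suc k)
  then obtain f' where f': "\<forall>x\<in>S. (f has_derivative f' x) (at x)" "\<forall>v. Ck_on k S (\<lambda>x. f' x v)"
    by auto
  have "((\<lambda>x. f (L x)) has_derivative (\<lambda>v. f' (L x) (L v))) (at x)" if "L x \<in> S" for x
    by (rule has_derivative_compose[OF bounded_linear_imp_has_derivative[OF L]])
       (use f' that in auto)
  moreover have "Ck_on k (L -` S) (\<lambda>x. f' (L x) (L v))" for v
    by (rule Suc.IH) (use f' in auto)
  ultimately show ?case unfolding Ck_on.simps
    by (intro exI[of _ "\<lambda>x v. f' (L x) (L v)"]) auto
qed

lemma smooth_on_bounded_linear: "bounded_linear f \<Longrightarrow> smooth_on S f"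
  by (simp add: smooth_on_def Ck_on_bounded_linear)

lemma smooth_on_mult:
  fixes f g :: "'a::euclidean_space \<Rightarrow> complex"
  shows "smooth_on S f \<Longrightarrow> smooth_on S g \<Longrightarrow> smooth_on S (\<lambda>x. f x * g x)"
  by (simp add: smooth_on_def Ck_on_mult)

lemma smooth_on_diff:
  fixes f g :: "'a::euclidean_space \<Rightarrow> complex"
  assumes "smooth_on S f" "smooth_on S g"
  shows "smooth_on S (\<lambda>x. f x - g x)"
proof -
  have "Ck_on k S (\<lambda>x. f x + (-1) * g x)" for k
    using assms by (intro Ck_on_add Ck_on_mult Ck_on_const) (auto simp: smooth_on_def)
  then show ?thesis by (simp add: smooth_on_def)
qed

lemma smooth_on_divide:
  fixes f g :: "'a::euclidean_space \<Rightarrow> complex"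
  assumes "smooth_on S f" "smooth_on S g" "\<And>x. x \<in> S \<Longrightarrow> g x \<noteq> 0"
  shows "smooth_on S (\<lambda>x. f x / g x)"
  using assms unfolding smooth_on_def divide_inverse by (intro allI Ck_on_mult Ck_on_inverse) auto

lemma smooth_on_vec:
  fixes f :: "'a::euclidean_space \<Rightarrow> 'b::euclidean_space ^ 'm"
  shows "(\<And>i. smooth_on S (\<lambda>x. f x $ i)) \<Longrightarrow> smooth_on S f"
  by (simp add: smooth_on_def Ck_on_vec)

lemma smooth_map_on_bounded_linear: "bounded_linear f \<Longrightarrow> smooth_map_on M f"
  unfolding smooth_map_on_def
  by (intro ballI exI[of _ UNIV] exI[of _ f]) (auto intro: smooth_on_bounded_linear)

section \<open>Symmetry of second derivatives\<close>

text \<open>Both mixed second derivatives are the limit of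
  \<open>(F (p + sY + sX) - F (p + sY) - F (p + sX) + F p) / s\<^sup>2\<close>.\<close>

lemma second_difference_limit:
  fixes F :: "'a::real_normed_vector \<Rightarrow> real"
  assumes U: "open U" "p \<in> U"
    and F: "\<And>x. x \<in> U \<Longrightarrow> (F has_derivative F' x) (at x)"
    and F2: "((\<lambda>x. F' x X) has_derivative H) (at p)"
  shows "((\<lambda>s. (F (p + s *\<^sub>R Y + s *\<^sub>R X) - F (p + s *\<^sub>R Y) - F (p + s *\<^sub>R X) + F p) / s\<^sup>2)
    \<longlongrightarrow> H Y) (at_right 0)"
proof (rule tendstoI)
  fix e :: real assume e: "e > 0"
  \<comment> \<open>The summand 1 keeps \<open>N\<close> positive when both vectors vanish. Below,
    two errors of size \<open>e' * (s * N)\<close> are added; the factor 4 in \<open>e'\<close>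
    makes their sum \<open>s * e / 2\<close>.\<close>
  define N where "N = norm X + norm Y + 1"
  have N: "N > 0" by (simp add: N_def add_nonneg_pos)
  define e' where "e' = e / (4 * N)"
  have e': "e' > 0" using e N by (simp add: e'_def)
  interpret H: bounded_linear H using F2 by (rule has_derivative_bounded_linear)
  obtain d1 where d1: "d1 > 0"
    "\<And>z. norm (z - p) < d1 \<Longrightarrow> norm (F' z X - F' p X - H (z - p)) \<le> e' * norm (z - p)"
    using F2 e' unfolding has_derivative_at_alt by blast
  obtain d2 where d2: "d2 > 0" "ball p d2 \<subseteq> U"
    using U openE by blast
  define d where "d = min d1 d2 / N"
  have d: "d > 0" using d1 d2 N by (simp add: d_def)
  have near: "norm (a *\<^sub>R Y + b *\<^sub>R X) \<le> s * N \<and> s * N < min d1 d2"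
    if "0 \<le> a" "a \<le> s" "0 \<le> b" "b \<le> s" "s < d" for a b s
  proof
    have "norm (a *\<^sub>R Y + b *\<^sub>R X) \<le> a * norm Y + b * norm X"
      using that norm_triangle_ineq[of "a *\<^sub>R Y" "b *\<^sub>R X"] by simp
    also have "\<dots> \<le> s * norm Y + s * norm X"
      using that by (intro add_mono mult_right_mono) auto
    also have "\<dots> \<le> s * N" using that by (simp add: N_def algebra_simps)
    finally show "norm (a *\<^sub>R Y + b *\<^sub>R X) \<le> s * N" .
    show "s * N < min d1 d2" using that N by (simp add: d_def field_simps)
  qed
  have inU: "p + (a *\<^sub>R Y + b *\<^sub>R X) \<in> U" if "0 \<le> a" "a \<le> s" "0 \<le> b" "b \<le> s" "s < d" for a b s
  proof -
    have "dist (p + (a *\<^sub>R Y + b *\<^sub>R X)) p < d2" using near[OF that] by (simp add: dist_norm)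
    then show ?thesis using d2(2) by (auto simp: dist_commute)
  qed
  have est: "norm (F' (p + (a *\<^sub>R Y + b *\<^sub>R X)) X - F' p X - H (a *\<^sub>R Y + b *\<^sub>R X)) \<le> e' * (s * N)"
    if "0 \<le> a" "a \<le> s" "0 \<le> b" "b \<le> s" "s < d" for a b s
  proof -
    have "norm (F' (p + (a *\<^sub>R Y + b *\<^sub>R X)) X - F' p X - H (a *\<^sub>R Y + b *\<^sub>R X))
        \<le> e' * norm (a *\<^sub>R Y + b *\<^sub>R X)"
      using d1(2)[of "p + (a *\<^sub>R Y + b *\<^sub>R X)"] near[OF that] by simp
    also have "\<dots> \<le> e' * (s * N)" using near[OF that] e' by (intro mult_left_mono) auto
    finally show ?thesis .
  qed
  have "dist ((F (p + s *\<^sub>R Y + s *\<^sub>R X) - F (p + s *\<^sub>R Y) - F (p + s *\<^sub>R X) + F p) / s\<^sup>2) (H Y) < e"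
    if s: "0 < s" "s < d" for s
  proof -
    \<comment> \<open>\<open>G\<close> compares \<open>F\<close> on two parallel segments in
      direction \<open>X\<close>. The mean value theorem gives one parameter \<open>t\<close> for
      both, so the terms \<open>t * H X\<close> cancel in the difference of the linearisations. The
      zero multiple of \<open>Y\<close> is written out to fit the shape of \<open>inU\<close> and
      \<open>est\<close>.\<close>
    define G where "G = (\<lambda>t. F (p + (s *\<^sub>R Y + t *\<^sub>R X)) - F (p + (0 *\<^sub>R Y + t *\<^sub>R X)))"
    have der: "(G has_derivative (\<lambda>h. F' (p + (s *\<^sub>R Y + t *\<^sub>R X)) (h *\<^sub>R X)
         - F' (p + (0 *\<^sub>R Y + t *\<^sub>R X)) (h *\<^sub>R X))) (at t)" if t: "0 \<le> t" "t \<le> s" for t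
    proof -
      have *: "((\<lambda>t. F (p + (a *\<^sub>R Y + t *\<^sub>R X))) has_derivative
          (\<lambda>h. F' (p + (a *\<^sub>R Y + t *\<^sub>R X)) (h *\<^sub>R X))) (at t)" if "0 \<le> a" "a \<le> s" for a
        by (rule has_derivative_compose[where f = "\<lambda>t. p + (a *\<^sub>R Y + t *\<^sub>R X)",
              OF _ F[OF inU[OF that t \<open>s < d\<close>]]])
           (auto intro!: derivative_eq_intros)
      show ?thesis unfolding G_def using s by (intro has_derivative_diff *) auto
    qed
    have lin: "F' z (h *\<^sub>R X) = h * F' z X" if "z \<in> U" for z h
    proof -
      interpret bounded_linear "F' z" using F[OF that] by (rule has_derivative_bounded_linear)
      show ?thesis by (simp add: scaleR)
    qed
    have "continuous_on {0..s} G"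
      using has_derivative_continuous[OF der] by (intro continuous_at_imp_continuous_on) auto
    from mvt[OF s(1) this der] obtain t where t: "0 < t" "t < s"
      "G s - G 0 = F' (p + (s *\<^sub>R Y + t *\<^sub>R X)) ((s - 0) *\<^sub>R X) - F' (p + (0 *\<^sub>R Y + t *\<^sub>R X)) ((s - 0) *\<^sub>R X)"
      by auto
    define P where "P = F' (p + (s *\<^sub>R Y + t *\<^sub>R X)) X"
    define Q where "Q = F' (p + (0 *\<^sub>R Y + t *\<^sub>R X)) X"
    have G: "G s - G 0 = s * (P - Q)"
      using t s by (simp add: lin inU[of s s t] inU[of 0 s t, simplified] P_def Q_def right_diff_distrib)
    have 1: "\<bar>P - F' p X - (s * H Y + t * H X)\<bar> \<le> e' * (s * N)"
      using est[of s s t] s t by (simp add: P_def H.add H.scaleR)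
    have 2: "\<bar>Q - F' p X - t * H X\<bar> \<le> e' * (s * N)"
      using est[of 0 s t] s t by (simp add: Q_def H.scaleR)
    have "\<bar>P - Q - s * H Y\<bar> \<le> 2 * (e' * (s * N))" using 1 2 by linarith
    also have "\<dots> < s * e" using s e N by (simp add: e'_def field_simps)
    finally have "\<bar>P - Q - s * H Y\<bar> < s * e" .
    then have "\<bar>(P - Q - s * H Y) / s\<bar> < e"
      using s by (simp add: abs_divide field_simps)
    moreover have "(P - Q - s * H Y) / s = (G s - G 0) / s\<^sup>2 - H Y"
      using s by (simp add: G power2_eq_square field_simps)
    ultimately have "\<bar>(G s - G 0) / s\<^sup>2 - H Y\<bar> < e" by simp
    moreover have "G s - G 0 = F (p + s *\<^sub>R Y + s *\<^sub>R X) - F (p + s *\<^sub>R Y) - F (p + s *\<^sub>R X) + F p"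
      by (simp add: G_def algebra_simps)
    ultimately show ?thesis by (simp add: dist_real_def)
  qed
  then show "\<forall>\<^sub>F s in at_right 0. dist ((F (p + s *\<^sub>R Y + s *\<^sub>R X) - F (p + s *\<^sub>R Y) - F (p + s *\<^sub>R X) + F p) / s\<^sup>2) (H Y) < e"
    using d by (auto simp: eventually_at_right_field)
qed

text \<open>The mean value theorem behind the limit concerns real functions, so the vector case is
  taken one coordinate at a time. Interchanging \<open>X\<close> and \<open>Y\<close> only permutes
  two terms of the second difference.\<close>

lemma second_derivative_symmetric:
  fixes F :: "'a::real_normed_vector \<Rightarrow> 'b::euclidean_space"
  assumes U: "open U" "p \<in> U"
    and F: "\<And>x. x \<in> U \<Longrightarrow> (F has_derivative F' x) (at x)"
    and X: "((\<lambda>x. F' x X) has_derivative HX) (at p)"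
    and Y: "((\<lambda>x. F' x Y) has_derivative HY) (at p)"
  shows "HX Y = HY X"
proof (rule euclidean_eqI)
  fix b :: 'b
  let ?F = "\<lambda>x. F x \<bullet> b"
  have *: "((\<lambda>s. (?F (p + s *\<^sub>R Y + s *\<^sub>R X) - ?F (p + s *\<^sub>R Y) - ?F (p + s *\<^sub>R X) + ?F p) / s\<^sup>2)
    \<longlongrightarrow> HX Y \<bullet> b) (at_right 0)"
    by (rule second_difference_limit[OF U, where F' = "\<lambda>x v. F' x v \<bullet> b"])
       (use F X in \<open>auto intro: has_derivative_inner_left\<close>)
  have "((\<lambda>s. (?F (p + s *\<^sub>R X + s *\<^sub>R Y) - ?F (p + s *\<^sub>R X) - ?F (p + s *\<^sub>R Y) + ?F p) / s\<^sup>2)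
    \<longlongrightarrow> HY X \<bullet> b) (at_right 0)"
    by (rule second_difference_limit[OF U, where F' = "\<lambda>x v. F' x v \<bullet> b"])
       (use F Y in \<open>auto intro: has_derivative_inner_left\<close>)
  then have "((\<lambda>s. (?F (p + s *\<^sub>R Y + s *\<^sub>R X) - ?F (p + s *\<^sub>R Y) - ?F (p + s *\<^sub>R X) + ?F p) / s\<^sup>2)
    \<longlongrightarrow> HY X \<bullet> b) (at_right 0)"
    by (simp add: algebra_simps)
  with * show "HX Y \<bullet> b = HY X \<bullet> b"
    using tendsto_unique trivial_limit_at_right_real by blast
qed

subsection \<open>Special unitary matrices\<close>

text \<open>For \<open>p\<close> different from \<open>q\<close> this is z E_pq - cnj z E_qp: a
  complex coordinate \<open>z\<close> on the real plane belonging to the roots x_p - x_q and x_q -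
  x_p. Exchanging the indices replaces \<open>z\<close> by \<open>- cnj z\<close>, so the order of
  \<open>p\<close> and \<open>q\<close> carries the sign of the root.\<close>

definition skew :: "'n + bool \<Rightarrow> 'n + bool \<Rightarrow> complex \<Rightarrow> ('n::finite) cmat" where
  "skew p q z = (\<chi> i j. if i = p \<and> j = q then z else if i = q \<and> j = p then - cnj z else 0)"

definition diag :: "('n + bool \<Rightarrow> complex) \<Rightarrow> ('n::finite) cmat" where
  "diag d = (\<chi> i j. if i = j then d i else 0)"

text \<open>For distinct \<open>p\<close>, \<open>q\<close> and |a|^2 + |b|^2 = 1 this is the copy
  of SU(2) acting on two coordinates. It serves twice: as a signed transposition and as a curve
  through the identity.\<close>

definition su2 :: "'n + bool \<Rightarrow> 'n + bool \<Rightarrow> complex \<Rightarrow> complex \<Rightarrow> ('n::finite) cmat" where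
  "su2 p q a b = (\<chi> i j.
     if i = p \<and> j = p then a else if i = q \<and> j = q then cnj a
     else if i = p \<and> j = q then b else if i = q \<and> j = p then - cnj b
     else if i = j then 1 else 0)"

lemma matrix_mult_nth: "(A ** B) $ i $ j = (\<Sum>k\<in>UNIV. A $ i $ k * B $ k $ j)"
  by (simp add: matrix_matrix_mult_def)

lemma dagger_nth [simp]: "dagger A $ i $ j = cnj (A $ j $ i)"
  by (simp add: dagger_def)

lemma mat_nth: "mat c $ i $ j = (if i = j then c else 0)"
  by (simp add: mat_def)

lemma cmat_eqI: "(\<And>i j. A $ i $ j = B $ i $ j) \<Longrightarrow> A = (B :: ('n::finite) cmat)"
  by (simp add: vec_eq_iff)

lemma dagger_dagger [simp]: "dagger (dagger A) = A"
  by (rule cmat_eqI) simp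

lemma dagger_mult: "dagger (A ** B) = dagger B ** dagger A"
  by (rule cmat_eqI) (simp add: matrix_mult_nth mult.commute)

lemma dagger_mat_1 [simp]: "dagger (mat 1) = mat 1"
  by (rule cmat_eqI) (simp add: mat_nth)

lemma bounded_linear_matrix_mult_left: "bounded_linear (\<lambda>X :: ('n::finite) cmat. A ** X)"
  by (rule linear_conv_bounded_linear[THEN iffD1], rule linearI)
     (simp_all add: vec_eq_iff matrix_mult_nth distrib_left sum.distrib scaleR_sum_right)

lemma bounded_linear_matrix_mult_right: "bounded_linear (\<lambda>X :: ('n::finite) cmat. X ** A)"
  by (rule linear_conv_bounded_linear[THEN iffD1], rule linearI)
     (simp_all add: vec_eq_iff matrix_mult_nth distrib_right sum.distrib scaleR_sum_right)

lemma bounded_linear_entry: "bounded_linear (\<lambda>X :: ('n::finite) cmat. X $ i $ j)"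
  using bounded_linear_compose[OF bounded_linear_vec_nth bounded_linear_vec_nth] .

lemma matrix_scaleR_right: "A ** (c *\<^sub>R B) = c *\<^sub>R (A ** (B :: ('n::finite) cmat))"
  by (simp add: vec_eq_iff matrix_mult_nth scaleR_sum_right)

lemma det_dagger: "det (dagger A) = cnj (det A)"
proof -
  have "det (dagger A) = det (\<chi> i j. cnj (A $ i $ j))"
    by (subst det_transpose[symmetric]) (simp add: transpose_def dagger_def)
  also have "\<dots> = cnj (det A)" by (simp add: det_def)
  finally show ?thesis .
qed

lemma SU_iff: "g \<in> SU \<longleftrightarrow> dagger g ** g = mat 1 \<and> det g = 1"
  using matrix_left_right_inverse by (auto simp: SU_def)

lemma SU_right: "g \<in> SU \<Longrightarrow> g ** dagger g = mat 1" by (simp add: SU_def)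
lemma SU_left: "g \<in> SU \<Longrightarrow> dagger g ** g = mat 1" by (simp add: SU_iff)

lemma SU_cancel_left: "g \<in> SU \<Longrightarrow> dagger g ** (g ** A) = A"
  by (simp add: matrix_mul_assoc SU_left)
lemma SU_cancel_right: "g \<in> SU \<Longrightarrow> g ** (dagger g ** A) = A"
  by (simp add: matrix_mul_assoc SU_right)

lemma SU_one: "mat 1 \<in> SU" by (simp add: SU_def)

lemma SU_mult: "g \<in> SU \<Longrightarrow> h \<in> SU \<Longrightarrow> g ** h \<in> SU"
  by (simp add: SU_iff dagger_mult det_mul matrix_mul_assoc[symmetric] SU_cancel_left)

lemma SU_dagger: "g \<in> SU \<Longrightarrow> dagger g \<in> SU"
  by (simp add: SU_iff SU_right det_dagger)

lemma SUH_SU: "k \<in> SUH \<Longrightarrow> k \<in> SU" by (simp add: SUH_def)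

lemma SUH_nth: "k \<in> SUH \<Longrightarrow> \<not> same_block i j \<Longrightarrow> k $ i $ j = 0" by (simp add: SUH_def)

lemma SU_orthonormal_columns:
  "g \<in> SU \<Longrightarrow> (\<Sum>k\<in>UNIV. cnj (g $ k $ i) * g $ k $ j) = (if i = j then 1 else 0)"
  using SU_left[of g] by (auto simp: vec_eq_iff matrix_mult_nth mat_nth)

lemma same_block_refl [simp]: "same_block i i" by (simp add: same_block_def)
lemma same_block_simps [simp]:
  "same_block (Inl i) (Inl j)" "\<not> same_block (Inl i) (Inr b)" "\<not> same_block (Inr b) (Inl i)"
  "same_block (Inr b) (Inr b') \<longleftrightarrow> b = b'"
  by (auto simp: same_block_def)

lemma mspace_iff:
  "X \<in> mspace \<longleftrightarrow> (\<forall>i j. cnj (X $ j $ i) = - X $ i $ j) \<and> (\<forall>i j. same_block i j \<longrightarrow> X $ i $ j = 0)"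
proof -
  have "dagger X = - X \<longleftrightarrow> (\<forall>i j. cnj (X $ j $ i) = - X $ i $ j)"
    by (simp add: vec_eq_iff)
  moreover have "mproj X = X \<longleftrightarrow> (\<forall>i j. same_block i j \<longrightarrow> X $ i $ j = 0)"
    by (auto simp: vec_eq_iff mproj_def)
  moreover have "trace X = 0" if "\<forall>i j. same_block i j \<longrightarrow> X $ i $ j = 0"
    using that by (simp add: trace_def)
  ultimately show ?thesis by (auto simp: mspace_def su_def)
qed

lemma mspace_skew_sym: "X \<in> mspace \<Longrightarrow> cnj (X $ j $ i) = - X $ i $ j" by (simp add: mspace_iff)
lemma mspace_block: "X \<in> mspace \<Longrightarrow> same_block i j \<Longrightarrow> X $ i $ j = 0" by (simp add: mspace_iff)

lemma mspace_add: "X \<in> mspace \<Longrightarrow> Y \<in> mspace \<Longrightarrow> X + Y \<in> mspace"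
  by (auto simp: mspace_iff)
lemma mspace_zero: "0 \<in> mspace"
  by (simp add: mspace_iff)
lemma mproj_mspace: "X \<in> mspace \<Longrightarrow> mproj X = X"
  by (simp add: mspace_def)

lemma skew_mspace: "\<not> same_block p q \<Longrightarrow> skew p q z \<in> mspace"
  by (auto simp: mspace_iff skew_def same_block_def)

lemma skew_scaleR: "skew p q (c *\<^sub>R z) = c *\<^sub>R skew p q z"
  by (simp add: vec_eq_iff skew_def)

lemma skew_minus: "skew p q (- z) = - skew p q z"
  by (simp add: vec_eq_iff skew_def)

lemma skew_add: "skew p q (z + w) = skew p q z + skew p q w"
proof (rule cmat_eqI)
  show "skew p q (z + w) $ i $ j = (skew p q z + skew p q w) $ i $ j" for i j
    by (cases "i = p"; cases "j = q"; cases "i = q"; cases "j = p")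
       (simp_all only: skew_def vec_lambda_beta complex_cnj_add minus_add_distrib if_True if_False
         simp_thms add_0 vector_add_component)
qed

lemma diag_conj: "(diag d ** X ** dagger (diag d)) $ i $ j = d i * X $ i $ j * cnj (d j)"
proof -
  have 1: "(diag d ** X) $ i $ k = d i * X $ i $ k" for k
  proof -
    have "(diag d ** X) $ i $ k = (\<Sum>l\<in>UNIV. if l = i then d i * X $ i $ k else 0)"
      unfolding matrix_mult_nth by (rule sum.cong) (auto simp: diag_def)
    then show ?thesis by simp
  qed
  have "(diag d ** X ** dagger (diag d)) $ i $ j
      = (\<Sum>l\<in>UNIV. if l = j then d i * X $ i $ j * cnj (d j) else 0)"
    unfolding matrix_mult_nth[of "diag d ** X"] 1 by (rule sum.cong) (auto simp: diag_def)
  then show ?thesis by simp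
qed

lemma diag_SUH:
  assumes "\<And>i. cmod (d i) = 1" "(\<Prod>i\<in>UNIV. d i) = 1"
  shows "diag d \<in> SUH"
proof -
  have "diag d ** dagger (diag d) = mat 1"
  proof (rule cmat_eqI)
    fix i j
    have "(diag d ** mat 1 ** dagger (diag d)) $ i $ j = (mat 1 :: 'a cmat) $ i $ j"
      unfolding diag_conj using assms(1)[of i]
      by (auto simp: mat_nth complex_norm_square[symmetric])
    then show "(diag d ** dagger (diag d)) $ i $ j = (mat 1 :: 'a cmat) $ i $ j" by simp
  qed
  moreover have "det (diag d) = 1"
    using assms(2) by (subst det_diagonal) (auto simp: diag_def)
  ultimately show ?thesis by (auto simp: SUH_def SU_def diag_def)
qed

lemma sum_eq_two:
  fixes f :: "'a::finite \<Rightarrow> 'b::comm_monoid_add"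
  assumes "p \<noteq> q" "\<And>k. k \<noteq> p \<Longrightarrow> k \<noteq> q \<Longrightarrow> f k = 0"
  shows "sum f UNIV = f p + f q"
proof -
  have "sum f UNIV = sum f {p, q}"
    by (rule sum.mono_neutral_right) (use assms in auto)
  then show ?thesis using assms(1) by simp
qed

lemma prod_eq_two:
  fixes f :: "'a::finite \<Rightarrow> 'b::comm_monoid_mult"
  assumes "p \<noteq> q" "\<And>k. k \<noteq> p \<Longrightarrow> k \<noteq> q \<Longrightarrow> f k = 1"
  shows "prod f UNIV = f p * f q"
proof -
  have "prod f UNIV = prod f {p, q}"
    by (rule prod.mono_neutral_right) (use assms in auto)
  then show ?thesis using assms(1) by simp
qed

lemma sum_eq_one:
  fixes f :: "'a::finite \<Rightarrow> 'b::comm_monoid_add"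
  assumes "\<And>k. k \<noteq> p \<Longrightarrow> f k = 0"
  shows "sum f UNIV = f p"
proof -
  have "sum f UNIV = sum f {p}"
    by (rule sum.mono_neutral_right) (use assms in auto)
  then show ?thesis by simp
qed

text \<open>Every row except \<open>p\<close> and \<open>q\<close> is that of the identity matrix,
  so only permutations moving nothing outside {p, q} contribute to the Leibniz formula.\<close>

lemma det_two_indices:
  fixes A :: "'a::comm_ring_1 ^ 'm ^ 'm"
  assumes pq: "p \<noteq> q"
    and A: "\<And>i. i \<noteq> p \<Longrightarrow> i \<noteq> q \<Longrightarrow> A $ i $ i = 1"
           "\<And>i j. i \<noteq> p \<Longrightarrow> i \<noteq> q \<Longrightarrow> i \<noteq> j \<Longrightarrow> A $ i $ j = 0"
  shows "det A = A $ p $ p * A $ q $ q - A $ p $ q * A $ q $ p"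
proof -
  let ?f = "\<lambda>s. of_int (sign s) * (\<Prod>i\<in>UNIV. A $ i $ s i)"
  have "det A = sum ?f {s. s permutes {p, q}}"
    unfolding det_def
  proof (rule sum.mono_neutral_right)
    show "\<forall>s\<in>{s. s permutes (UNIV::'m set)} - {s. s permutes {p, q}}. ?f s = 0"
    proof
      fix s assume s: "s \<in> {s. s permutes (UNIV::'m set)} - {s. s permutes {p, q}}"
      then obtain i where i: "i \<notin> {p, q}" "s i \<noteq> i"
        using permutes_superset[of s UNIV "{p, q}"] by blast
      then have "A $ i $ s i = 0" using A(2) by auto
      then have "(\<Prod>i\<in>UNIV. A $ i $ s i) = 0" by (intro prod_zero) auto
      then show "?f s = 0" by simp
    qed
  qed (auto intro: permutes_subset)
  also have "{s. s permutes {p, q}} = {id, Transposition.transpose p q}"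
    by (auto simp: permutes_doubleton_iff)
  also have "sum ?f \<dots> = ?f id + ?f (Transposition.transpose p q)"
    using pq by (subst sum.insert) (auto simp: fun_eq_iff, metis transpose_apply_first)
  also have "(\<Prod>i\<in>UNIV. A $ i $ id i) = A $ p $ p * A $ q $ q"
    using prod_eq_two[OF pq, of "\<lambda>i. A $ i $ id i"] A(1) by simp
  also have "(\<Prod>i\<in>UNIV. A $ i $ Transposition.transpose p q i) = A $ p $ q * A $ q $ p"
    using prod_eq_two[OF pq, of "\<lambda>i. A $ i $ Transposition.transpose p q i"] A(1) by simp
  finally show ?thesis using pq by (simp add: sign_swap_id)
qed

lemma su2_SU:
  assumes pq: "p \<noteq> q" and ab: "(cmod a)\<^sup>2 + (cmod b)\<^sup>2 = 1"
  shows "su2 p q a b \<in> SU"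
proof -
  have ab': "a * cnj a + b * cnj b = 1"
    using arg_cong[OF ab, of complex_of_real] by (simp only: of_real_add complex_norm_square of_real_1)
  have qp: "q \<noteq> p" using pq by auto
  let ?S = "su2 p q a b"
  have "(?S ** dagger ?S) $ i $ j = (mat 1 :: 'a cmat) $ i $ j" for i j
  proof -
    consider "i \<noteq> p" "i \<noteq> q" | "i = p \<or> i = q" by blast
    then show ?thesis
    proof cases
      case 1
      then have "(?S ** dagger ?S) $ i $ j = ?S $ i $ i * cnj (?S $ j $ i)"
        unfolding matrix_mult_nth by (subst sum_eq_one[of i]) (auto simp: su2_def)
      then show ?thesis using 1 by (auto simp: su2_def mat_nth)
    next
      case 2
      then have *: "(?S ** dagger ?S) $ i $ j
          = ?S $ i $ p * cnj (?S $ j $ p) + ?S $ i $ q * cnj (?S $ j $ q)"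
        unfolding matrix_mult_nth by (subst sum_eq_two[OF pq]) (auto simp: su2_def)
      show ?thesis
        unfolding * using 2 pq qp ab'
        by (cases "j = p"; cases "j = q"; elim disjE)
           (simp_all add: su2_def mat_nth mult.commute add.commute)
    qed
  qed
  then have "?S ** dagger ?S = mat 1" by (rule cmat_eqI)
  moreover have "det ?S = 1"
    using pq qp ab' by (subst det_two_indices[OF pq]) (auto simp: su2_def algebra_simps)
  ultimately show ?thesis by (simp add: SU_def)
qed

text \<open>For unit \<open>z\<close> the curve stays in \<open>SU\<close>, so it tests the
  derivative of a map that is controlled only on \<open>SU\<close>.\<close>

lemma su2_curve_derivative:
  assumes "p \<noteq> q"
  shows "((\<lambda>t. su2 p q (of_real (cos t)) (of_real (sin t) * z)) has_derivative
    (\<lambda>t. t *\<^sub>R skew p q z)) (at 0)"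
proof (intro has_derivative_vec)
  fix i j
  have c: "((\<lambda>t. complex_of_real (cos t)) has_derivative (\<lambda>t. 0)) (at 0)"
    by (rule has_derivative_eq_rhs, rule has_derivative_of_real, rule has_derivative_cos)
       (auto intro: has_derivative_ident)
  have s: "((\<lambda>t. complex_of_real (sin t) * w) has_derivative (\<lambda>t. of_real t * w)) (at 0)" for w
    by (rule has_derivative_eq_rhs, rule has_derivative_mult_left, rule has_derivative_of_real,
        rule has_derivative_sin) (auto intro: has_derivative_ident)
  show "((\<lambda>t. su2 p q (of_real (cos t)) (of_real (sin t) * z) $ i $ j) has_derivative
      (\<lambda>t. (t *\<^sub>R skew p q z) $ i $ j)) (at 0)"
    using assms c s[of z] s[of "- cnj z"]
    by (cases "i = p"; cases "j = p"; cases "i = q"; cases "j = q")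
       (auto simp: su2_def skew_def scaleR_conv_of_real[where 'a = complex])
qed

lemma su2_curve_SU:
  assumes "p \<noteq> q" "cmod z = 1"
  shows "su2 p q (of_real (cos t)) (of_real (sin t) * z) \<in> SU"
  using assms by (intro su2_SU) (simp_all add: norm_mult)

subsection \<open>Invariant almost complex structures and their roots\<close>

text \<open>\<open>a\<close>, \<open>b\<close>, \<open>c\<close> are the signs on the pairs A-B, A-C
  and B-C. Antisymmetry is forced: multiplying entries by i times a real antisymmetric factor keeps
  a matrix skew-Hermitian.\<close>

fun block_sign :: "real \<Rightarrow> real \<Rightarrow> real \<Rightarrow> 'n + bool \<Rightarrow> 'n + bool \<Rightarrow> real" where
  "block_sign a b c (Inl i) (Inl j) = 0"
| "block_sign a b c (Inl i) (Inr False) = a"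
| "block_sign a b c (Inl i) (Inr True) = b"
| "block_sign a b c (Inr False) (Inl i) = - a"
| "block_sign a b c (Inr False) (Inr False) = 0"
| "block_sign a b c (Inr False) (Inr True) = c"
| "block_sign a b c (Inr True) (Inl i) = - b"
| "block_sign a b c (Inr True) (Inr False) = - c"
| "block_sign a b c (Inr True) (Inr True) = 0"

definition sign_acs :: "real \<Rightarrow> real \<Rightarrow> real \<Rightarrow> ('n::finite) cmat \<Rightarrow> 'n cmat" where
  "sign_acs a b c X = (\<chi> i j. \<i> * of_real (block_sign a b c i j) * X $ i $ j)"

lemma index_cases [case_names A B C]:
  fixes p :: "'n + bool"
  obtains i where "p = Inl i" | "p = Inr False" | "p = Inr True"
  by (cases p) auto

lemma block_sign_cong:
  assumes "same_block p p'" "same_block q q'"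
  shows "block_sign a b c p q = block_sign a b c p' q'"
  using assms
  by (cases p rule: index_cases; cases q rule: index_cases;
      cases p' rule: index_cases; cases q' rule: index_cases) auto

lemma block_sign_swap: "block_sign a b c q p = - block_sign a b c p q"
  by (cases p rule: index_cases; cases q rule: index_cases) auto

lemma block_sign_same_block: "same_block p q \<Longrightarrow> block_sign a b c p q = 0"
  by (cases p rule: index_cases; cases q rule: index_cases) auto

lemma block_sign_cases:
  assumes "\<not> same_block p q" "a \<in> {1, -1}" "b \<in> {1, -1}" "c \<in> {1, -1}"
  shows "block_sign a b c p q \<in> {1, -1}"
  using assms by (cases p rule: index_cases; cases q rule: index_cases) auto

lemma sign_acs_nth [simp]:
  "sign_acs a b c X $ i $ j = \<i> * of_real (block_sign a b c i j) * X $ i $ j"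
  by (simp add: sign_acs_def)

lemma sign_acs_skew:
  "sign_acs a b c (skew p q z) = skew p q (\<i> * of_real (block_sign a b c p q) * z)"
proof (rule cmat_eqI)
  fix i j
  show "sign_acs a b c (skew p q z) $ i $ j = skew p q (\<i> * of_real (block_sign a b c p q) * z) $ i $ j"
    using block_sign_swap[of a b c q p] by (auto simp: skew_def)
qed

lemma sign_acs_mspace: "X \<in> mspace \<Longrightarrow> sign_acs a b c X \<in> mspace"
proof -
  assume X: "X \<in> mspace"
  have "cnj (sign_acs a b c X $ j $ i) = - sign_acs a b c X $ i $ j" for i j
    using mspace_skew_sym[OF X, of j i] block_sign_swap[of a b c j i] by simp
  then show ?thesis using mspace_block[OF X] by (auto simp: mspace_iff)
qed

text \<open>An entry \<open>X $ l $ m\<close> reaches position i, j of the conjugate only if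
  \<open>l\<close> is in the block of \<open>i\<close> and \<open>m\<close> in that of
  \<open>j\<close>, and the sign is constant on pairs of blocks. So the factor moves through both
  products term by term.\<close>

lemma sign_acs_SUH:
  assumes k: "k \<in> SUH"
  shows "sign_acs a b c (k ** X ** dagger k) = k ** sign_acs a b c X ** dagger k"
proof (rule cmat_eqI)
  fix i j
  have *: "\<i> * of_real (block_sign a b c i j) * (k $ i $ l * X $ l $ m * cnj (k $ j $ m))
      = k $ i $ l * (\<i> * of_real (block_sign a b c l m) * X $ l $ m) * cnj (k $ j $ m)" for l m
  proof (cases "same_block i l \<and> same_block j m")
    case True
    then show ?thesis by (simp add: block_sign_cong[of i l j m])
  next
    case False
    then show ?thesis using SUH_nth[OF k] by auto
  qed
  show "sign_acs a b c (k ** X ** dagger k) $ i $ j = (k ** sign_acs a b c X ** dagger k) $ i $ j"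
    unfolding sign_acs_nth matrix_mult_nth sum_distrib_left sum_distrib_right dagger_nth
    by (intro sum.cong refl *)
qed

lemma invariant_sign_acs:
  assumes "a \<in> {1, -1}" "b \<in> {1, -1}" "c \<in> {1, -1}"
  shows "invariant_acs (sign_acs a b c)"
  unfolding invariant_acs_def
proof (intro conjI ballI allI)
  fix X :: "'a cmat" assume X: "X \<in> mspace"
  show "sign_acs a b c (sign_acs a b c X) = - X"
  proof (rule cmat_eqI)
    fix i j
    show "sign_acs a b c (sign_acs a b c X) $ i $ j = (- X) $ i $ j"
      using mspace_block[OF X, of i j] block_sign_cases[of i j, OF _ assms]
      by (cases "same_block i j") auto
  qed
qed (auto simp: sign_acs_mspace sign_acs_SUH vec_eq_iff algebra_simps)

lemma conjugate_sign_acs: "conjugate_acs (sign_acs a b c :: ('n::finite) cmat \<Rightarrow> 'n cmat) = sign_acs (- a) (- b) (- c)"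
proof -
  have "block_sign (- a) (- b) (- c) i j = - block_sign a b c i j" for i j :: "'n + bool"
    by (cases i rule: index_cases; cases j rule: index_cases) auto
  then show ?thesis by (simp add: conjugate_acs_def fun_eq_iff vec_eq_iff)
qed

section \<open>Roots and root spaces\<close>

definition root_form :: "'n + bool \<Rightarrow> 'n + bool \<Rightarrow> ('n::finite) cmat \<Rightarrow> real" where
  "root_form p q = (\<lambda>h\<in>torus_algebra. xcoord p h - xcoord q h)"

text \<open>Subtracting the mean makes the trace vanish and leaves all differences unchanged, so
  identities between roots can be tested on arbitrary real functions of the index.\<close>

definition torus_element :: "('n + bool \<Rightarrow> real) \<Rightarrow> ('n::finite) cmat" where
  "torus_element t = diag (\<lambda>k. \<i> * of_real (t k - (\<Sum>l\<in>UNIV. t l) / real CARD('n + bool)))"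

lemma torus_element_torus_algebra: "(torus_element t :: ('n::finite) cmat) \<in> torus_algebra"
proof -
  have "trace (torus_element t :: 'n cmat) = \<i> * of_real (\<Sum>k\<in>UNIV. t k - (\<Sum>l\<in>UNIV. t l) / real CARD('n + bool))"
    by (simp add: trace_def torus_element_def diag_def sum_distrib_left)
  also have "(\<Sum>k\<in>UNIV. t k - (\<Sum>l\<in>UNIV. t l) / real CARD('n + bool)) = 0"
    unfolding sum_subtractf sum_constant by simp
  finally have "trace (torus_element t :: 'n cmat) = 0" by simp
  then show ?thesis
    by (auto simp: torus_algebra_def su_def torus_element_def diag_def vec_eq_iff)
qed

lemma root_form_torus_element: "root_form p q (torus_element t) = t p - t q"
  using torus_element_torus_algebra[of t]
  by (simp add: root_form_def xcoord_def) (simp add: torus_element_def diag_def)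

lemma root_form_eq_iff:
  assumes "p \<noteq> q"
  shows "root_form p q = (root_form r s :: ('n::finite) cmat \<Rightarrow> real) \<longleftrightarrow> p = r \<and> q = s"
proof
  assume eq: "root_form p q = (root_form r s :: 'n cmat \<Rightarrow> real)"
  have *: "t p - t q = t r - t s" for t :: "'n + bool \<Rightarrow> real"
    using fun_cong[OF eq, of "torus_element t"] by (simp add: root_form_torus_element)
  show "p = r \<and> q = s"
    using assms *[of "\<lambda>k. if k = p then 1 else 0"] *[of "\<lambda>k. if k = q then 1 else 0"]
    by (auto split: if_splits)
qed auto

text \<open>A root determines its index pair, so the set difference discards exactly the pairs
  within a block.\<close>

lemma complementary_roots_eq: "complementary_roots = {root_form p q | p q. \<not> same_block p q}"
proof -
  have g: "roots_g = {root_form p q | p q. p \<noteq> q}"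
    and h: "roots_h = {root_form p q | p q. p \<noteq> q \<and> same_block p q}"
    by (auto simp: roots_g_def roots_h_def root_form_def)
  have "p \<noteq> q" if "\<not> same_block p q" for p q :: "'a + bool"
    using that by auto
  then show ?thesis unfolding complementary_roots_def g h
    by (auto simp: root_form_eq_iff)
qed

lemma bracket_torus_nth:
  assumes h: "h \<in> torus_algebra"
  shows "bracket h X $ i $ j = \<i> * of_real (xcoord i h - xcoord j h) * X $ i $ j"
proof -
  have off: "h $ k $ l = 0" if "k \<noteq> l" for k l
    using h that by (auto simp: torus_algebra_def)
  have dia: "h $ k $ k = \<i> * of_real (xcoord k h)" for k
  proof -
    have "dagger h = - h" using h by (simp add: torus_algebra_def su_def)
    then have "cnj (h $ k $ k) = - h $ k $ k" by (metis dagger_nth vector_uminus_component)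
    then show ?thesis by (simp add: complex_eq_iff xcoord_def)
  qed
  have "(h ** X) $ i $ j = h $ i $ i * X $ i $ j"
    unfolding matrix_mult_nth by (rule sum_eq_one) (simp add: off)
  moreover have "(X ** h) $ i $ j = X $ i $ j * h $ j $ j"
    unfolding matrix_mult_nth by (rule sum_eq_one) (simp add: off)
  ultimately show ?thesis by (simp add: bracket_def dia algebra_simps)
qed

lemma bracket_torus_skew:
  assumes h: "h \<in> torus_algebra" and "p \<noteq> q"
  shows "bracket h (skew p q z) = root_form p q h *\<^sub>R skew p q (\<i> * z)"
  by (rule cmat_eqI)
     (use assms in \<open>auto simp: bracket_torus_nth skew_def root_form_def scaleR_conv_of_real[where 'a = complex] algebra_simps\<close>)

text \<open>On the entry at i, j, the square of ad h is multiplication by -(x_i - x_j)^2. Off the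
  two positions of the root some \<open>h\<close> makes this differ from the prescribed scalar, so
  the entry vanishes; the skew-Hermitian condition ties the two entries that remain.\<close>

lemma root_space_eq:
  assumes pq: "p \<noteq> q"
  shows "root_space (root_form p q) = range (skew p q)"
proof (intro set_eqI iffI)
  fix X :: "'a cmat" assume "X \<in> root_space (root_form p q)"
  then have su: "dagger X = - X"
    and b: "\<And>h. h \<in> torus_algebra \<Longrightarrow> bracket h (bracket h X) = - ((root_form p q h)\<^sup>2 *\<^sub>R X)"
    by (auto simp: root_space_def su_def)
  have *: "(t i - t j)\<^sup>2 *\<^sub>R X $ i $ j = (t p - t q)\<^sup>2 *\<^sub>R X $ i $ j" for t :: "'a + bool \<Rightarrow> real" and i j
  proof -
    let ?h = "torus_element t :: 'a cmat"
    have d: "xcoord i ?h - xcoord j ?h = t i - t j" for i j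
      using root_form_torus_element[of i j t] torus_element_torus_algebra[of t]
      by (simp add: root_form_def)
    have "bracket ?h (bracket ?h X) $ i $ j = - ((t p - t q)\<^sup>2 *\<^sub>R X $ i $ j)"
      using b[OF torus_element_torus_algebra[of t]] by (simp add: root_form_torus_element)
    moreover have "bracket ?h (bracket ?h X) $ i $ j = - ((t i - t j)\<^sup>2 *\<^sub>R X $ i $ j)"
      unfolding bracket_torus_nth[OF torus_element_torus_algebra] d
      by (simp add: scaleR_conv_of_real power2_eq_square algebra_simps)
    ultimately show ?thesis by simp
  qed
  have zero: "X $ i $ j = 0" if nz: "\<not> (i = p \<and> j = q)" "\<not> (i = q \<and> j = p)" for i j
  proof -
    consider "i = j" | "i \<noteq> j" "i \<notin> {p, q}" | "i \<noteq> j" "j \<notin> {p, q}"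
      using nz by auto
    then show ?thesis
    proof cases
      case 1
      then show ?thesis using *[of "\<lambda>k. if k = p then 1 else 0" i j] pq by auto
    next
      case 2
      then show ?thesis using *[of "\<lambda>k. if k = i then 1 else 0" i j] by auto
    next
      case 3
      then show ?thesis using *[of "\<lambda>k. if k = j then 1 else 0" i j] by auto
    qed
  qed
  have "X $ q $ p = - cnj (X $ p $ q)"
    using arg_cong[OF su, of "\<lambda>A. A $ q $ p"] by simp
  then have "X = skew p q (X $ p $ q)"
    using zero pq by (auto simp: vec_eq_iff skew_def)
  then show "X \<in> range (skew p q)" by blast
next
  fix X :: "'a cmat" assume "X \<in> range (skew p q)"
  then obtain z where X: "X = skew p q z" by blast
  have "X \<in> su" using pq by (auto simp: X su_def vec_eq_iff skew_def trace_def intro!: sum.neutral)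
  moreover have "bracket h (bracket h X) = - ((root_form p q h)\<^sup>2 *\<^sub>R X)" if h: "h \<in> torus_algebra" for h
  proof (rule cmat_eqI)
    fix i j
    show "bracket h (bracket h X) $ i $ j = (- ((root_form p q h)\<^sup>2 *\<^sub>R X)) $ i $ j"
      using h pq
      by (auto simp: bracket_torus_nth[OF h] X skew_def root_form_def power2_eq_square
          scaleR_conv_of_real[where 'a = complex] algebra_simps)
  qed
  ultimately show "X \<in> root_space (root_form p q)" by (simp add: root_space_def)
qed

lemma acs_roots_eq:
  "acs_roots K = {root_form p q | p q. \<not> same_block p q \<and> (\<forall>z. K (skew p q z) = skew p q (\<i> * z))}"
proof -
  have "(\<forall>h\<in>torus_algebra. \<forall>X\<in>root_space (root_form p q). bracket h X = root_form p q h *\<^sub>R K X)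
      \<longleftrightarrow> (\<forall>z. K (skew p q z) = skew p q (\<i> * z))" (is "?l \<longleftrightarrow> ?r")
    if "\<not> same_block p q" for p q
  proof -
    have pq: "p \<noteq> q" using that by auto
    show ?thesis
    proof
      assume l: ?l
      show ?r
      proof
        fix z
        \<comment> \<open>The root takes the value 1 on this element, so the weight condition there
          reads \<open>bracket h X = K X\<close>.\<close>
        let ?h = "torus_element (\<lambda>k. if k = p then 1 else 0) :: 'a cmat"
        have "root_form p q ?h = 1" using pq by (simp add: root_form_torus_element)
        with bspec[OF bspec[OF l torus_element_torus_algebra, of "\<lambda>k. if k = p then 1 else 0"], of "skew p q z"]
        show "K (skew p q z) = skew p q (\<i> * z)"
          using pq by (simp add: root_space_eq bracket_torus_skew torus_element_torus_algebra)
      qed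
    next
      assume ?r
      then show ?l using pq by (auto simp: root_space_eq bracket_torus_skew)
    qed
  qed
  then show ?thesis unfolding acs_roots_def complementary_roots_eq by blast
qed

lemma acs_roots_sign_acs:
  "acs_roots (sign_acs a b c :: ('n::finite) cmat \<Rightarrow> 'n cmat) = {root_form p q | p q. block_sign a b c p q = 1}"
proof -
  have "(\<forall>z. sign_acs a b c (skew p q z :: 'n cmat) = skew p q (\<i> * z)) \<longleftrightarrow> block_sign a b c p q = 1"
    if "\<not> same_block p q" for p q :: "'n + bool"
  proof
    assume "\<forall>z. sign_acs a b c (skew p q z :: 'n cmat) = skew p q (\<i> * z)"
    then have "sign_acs a b c (skew p q 1 :: 'n cmat) $ p $ q = skew p q (\<i> * 1) $ p $ q" by simp
    then show "block_sign a b c p q = 1" by (simp add: skew_def)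
  qed (simp add: sign_acs_skew)
  then show ?thesis unfolding acs_roots_eq
    using block_sign_same_block by (metis (no_types, opaque_lifting) zero_neq_one)
qed

subsection \<open>Classification up to equivalence\<close>

text \<open>There are at least three coordinates because n is positive. The extra one absorbs the
  determinant when a diagonal element of \<open>SUH\<close> is prescribed at \<open>p\<close> and
  \<open>q\<close>.\<close>

lemma ex_third_index: "\<exists>r :: 'n::finite + bool. r \<noteq> p \<and> r \<noteq> q"
proof (rule ccontr)
  assume "\<not> ?thesis"
  then have "(UNIV :: ('n + bool) set) \<subseteq> {p, q}" by auto
  then have "card (UNIV :: ('n + bool) set) \<le> card {p, q}" by (intro card_mono) auto
  also have "\<dots> \<le> 2" by (simp add: card_insert_if)
  finally have "CARD('n) + 2 \<le> 2" by (simp add: card_UNIV_sum[symmetric])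
  then show False by simp
qed

lemma
  assumes K: "invariant_acs K"
  shows invariant_acs_mspace: "X \<in> mspace \<Longrightarrow> K X \<in> mspace"
    and invariant_acs_add: "X \<in> mspace \<Longrightarrow> Y \<in> mspace \<Longrightarrow> K (X + Y) = K X + K Y"
    and invariant_acs_scaleR: "X \<in> mspace \<Longrightarrow> K (c *\<^sub>R X) = c *\<^sub>R K X"
    and invariant_acs_square: "X \<in> mspace \<Longrightarrow> K (K X) = - X"
    and invariant_acs_SUH: "k \<in> SUH \<Longrightarrow> X \<in> mspace \<Longrightarrow>
      K (k ** X ** dagger k) = k ** K X ** dagger k"
proof -
  note K' = K[unfolded invariant_acs_def]
  show "X \<in> mspace \<Longrightarrow> K X \<in> mspace"
    by (rule bspec[OF conjunct1[OF K']])
  show "X \<in> mspace \<Longrightarrow> Y \<in> mspace \<Longrightarrow> K (X + Y) = K X + K Y"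
    by (rule bspec[OF bspec[OF conjunct1[OF conjunct2[OF K']]]])
  show "X \<in> mspace \<Longrightarrow> K (c *\<^sub>R X) = c *\<^sub>R K X"
    by (rule bspec[OF spec[OF conjunct1[OF conjunct2[OF conjunct2[OF K']]]]])
  show "X \<in> mspace \<Longrightarrow> K (K X) = - X"
    by (rule bspec[OF conjunct1[OF conjunct2[OF conjunct2[OF conjunct2[OF K']]]]])
  show "k \<in> SUH \<Longrightarrow> X \<in> mspace \<Longrightarrow> K (k ** X ** dagger k) = k ** K X ** dagger k"
    by (rule bspec[OF bspec[OF conjunct2[OF conjunct2[OF conjunct2[OF conjunct2[OF K']]]]]])
qed

lemma invariant_acs_sum:
  assumes K: "invariant_acs K" and f: "\<And>i. i \<in> A \<Longrightarrow> f i \<in> mspace"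
  shows "K (sum f A) = (\<Sum>i\<in>A. K (f i)) \<and> sum f A \<in> mspace"
proof -
  have 0: "K 0 = 0" using invariant_acs_scaleR[OF K mspace_zero, of 0] by simp
  show ?thesis using f
    by (induction A rule: infinite_finite_induct)
       (auto simp: 0 mspace_zero mspace_add invariant_acs_add[OF K])
qed

lemma invariant_acs_root_space:
  fixes K :: "('n::finite) cmat \<Rightarrow> 'n cmat"
  assumes K: "invariant_acs K" and pq: "\<not> same_block p q"
  shows "K (skew p q z) = skew p q (K (skew p q z) $ p $ q)"
proof -
  have ne: "p \<noteq> q" using pq by auto
  let ?Y = "K (skew p q z)"
  have Y: "?Y \<in> mspace" by (rule invariant_acs_mspace[OF K skew_mspace[OF pq]])
  have outside: "?Y $ r $ j = 0" if r: "r \<noteq> p" "r \<noteq> q" for r j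
  proof (cases "j = r")
    case True
    then show ?thesis using mspace_block[OF Y] by auto
  next
    case False
    \<comment> \<open>The determinant is i * i * (-1) = 1. This element fixes the plane of
      \<open>p\<close>, \<open>q\<close> and multiplies the entry at r, j by i for \<open>j\<close>
      in {p, q} and by -1 for any other \<open>j\<close> distinct from \<open>r\<close>, so
      invariance forces that entry to vanish.\<close>
    define d :: "'n + bool \<Rightarrow> complex"
      where "d = (\<lambda>k. if k = p \<or> k = q then \<i> else if k = r then - 1 else 1)"
    have "prod d UNIV = prod d {p, q, r}"
      by (rule prod.mono_neutral_right) (auto simp: d_def)
    also have "\<dots> = 1" using ne r by (auto simp: d_def)
    finally have H: "diag d \<in> SUH" by (intro diag_SUH) (auto simp: d_def)
    have "diag d ** skew p q z ** dagger (diag d) = skew p q z"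
      by (rule cmat_eqI) (auto simp: diag_conj skew_def d_def)
    then have "?Y = diag d ** ?Y ** dagger (diag d)"
      using invariant_acs_SUH[OF K H skew_mspace[OF pq]] by metis
    then have "?Y $ r $ j = d r * ?Y $ r $ j * cnj (d j)"
      using diag_conj[of d ?Y r j] by simp
    then have "(1 - d r * cnj (d j)) * ?Y $ r $ j = 0" by (simp add: algebra_simps)
    moreover have "1 - d r * cnj (d j) \<noteq> 0"
      using r False by (auto simp: d_def complex_eq_iff)
    ultimately show ?thesis by simp
  qed
  have outside': "?Y $ j $ r = 0" if r: "r \<noteq> p" "r \<noteq> q" for r j
    using mspace_skew_sym[OF Y, of r j] outside[OF r, of j] by simp
  have "?Y $ q $ p = - cnj (?Y $ p $ q)"
    using mspace_skew_sym[OF Y, of p q] by simp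
  moreover have "?Y $ p $ p = 0" "?Y $ q $ q = 0" using mspace_block[OF Y] by auto
  ultimately have "?Y $ i $ j = skew p q (?Y $ p $ q) $ i $ j" for i j
    using outside[of i j] outside'[of j i] ne
    by (cases "i = p"; cases "i = q"; cases "j = p"; cases "j = q")
       (auto simp: skew_def[of p q "?Y $ p $ q"])
  then show ?thesis by (rule cmat_eqI)
qed

lemma invariant_acs_skew:
  fixes K :: "('n::finite) cmat \<Rightarrow> 'n cmat"
  assumes K: "invariant_acs K" and pq: "\<not> same_block p q"
  shows "\<exists>s\<in>{1, -1 :: real}. \<forall>z. K (skew p q z) = skew p q (\<i> * of_real s * z)"
proof -
  have ne: "p \<noteq> q" using pq by auto
  note sm = skew_mspace[OF pq]
  define w where "w z = K (skew p q z) $ p $ q" for z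
  have w: "K (skew p q z) = skew p q (w z)" for z
    using invariant_acs_root_space[OF K pq] by (simp add: w_def)
  have w_add: "w (z + z') = w z + w z'" for z z'
    by (simp add: w_def skew_add invariant_acs_add[OF K sm sm])
  have w_scaleR: "w (c *\<^sub>R z) = c *\<^sub>R w z" for c z
    by (simp add: w_def skew_scaleR invariant_acs_scaleR[OF K sm])
  have w_i: "w (\<i> * z) = \<i> * w z" for z
  proof -
    obtain r where r: "r \<noteq> p" "r \<noteq> q" using ex_third_index by blast
    \<comment> \<open>This element multiplies the coordinate \<open>z\<close> by i, and the entry -i
      at \<open>r\<close> restores determinant 1. Thus the real linear map \<open>w\<close> commutes
      with i, so it is multiplication by a complex number, which must square to -1.\<close>
    define d :: "'n + bool \<Rightarrow> complex"
      where "d = (\<lambda>k. if k = p then \<i> else if k = r then - \<i> else 1)"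
    have "prod d UNIV = d p * d r"
      using r by (intro prod_eq_two) (auto simp: d_def)
    then have H: "diag d \<in> SUH" using r by (intro diag_SUH) (auto simp: d_def)
    have "diag d ** skew p q z ** dagger (diag d) = skew p q (\<i> * z)"
      using r ne by (intro cmat_eqI) (auto simp: diag_conj skew_def d_def)
    then have "w (\<i> * z) = (diag d ** K (skew p q z) ** dagger (diag d)) $ p $ q"
      using invariant_acs_SUH[OF K H sm[of z]] by (simp add: w_def)
    also have "\<dots> = \<i> * w z" using r ne by (simp add: diag_conj d_def w_def)
    finally show ?thesis .
  qed
  have w_lin: "w z = w 1 * z" for z
  proof -
    have "w z = w (Re z *\<^sub>R 1 + \<i> * (Im z *\<^sub>R 1))"
      by (rule arg_cong[of _ _ w]) (simp add: complex_eq_iff)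
    also have "\<dots> = Re z *\<^sub>R w 1 + \<i> * (Im z *\<^sub>R w 1)"
      by (simp only: w_add w_i w_scaleR)
    also have "\<dots> = w 1 * z" by (simp add: complex_eq_iff algebra_simps)
    finally show ?thesis .
  qed
  have "skew p q (w (w 1)) = - skew p q 1"
    using invariant_acs_square[OF K sm, of 1] by (simp add: w)
  from arg_cong[OF this, of "\<lambda>A. A $ p $ q"] have "w (w 1) = - 1"
    by (simp add: skew_def)
  then have "(w 1 - \<i>) * (w 1 + \<i>) = 0" using w_lin[of "w 1"] by (simp add: algebra_simps)
  then have "w 1 = \<i> * of_real 1 \<or> w 1 = \<i> * of_real (- 1)"
    by (auto simp: eq_neg_iff_add_eq_0)
  then obtain s :: real where s: "s \<in> {1, -1}" "w 1 = \<i> * of_real s" by blast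
  have "K (skew p q z) = skew p q (\<i> * of_real s * z)" for z
    by (subst w, subst w_lin) (simp only: s(2))
  then show ?thesis using s(1) by blast
qed

text \<open>A plain transposition has determinant -1; \<open>su2 p p' 0 1\<close> is the
  transposition with one sign changed, which brings it into \<open>SU\<close>. The sign enters the
  coordinate only as a real factor.\<close>

lemma su2_conj_skew:
  assumes "p \<noteq> p'" "q \<noteq> p" "q \<noteq> p'"
  shows "su2 p p' 0 1 ** skew p q z ** dagger (su2 p p' 0 1) = skew p' q (- z)"
proof -
  define t where "t k = (if k = p then p' else if k = p' then p else k)" for k
  define c where "c k = (if k = p' then - 1 else 1 :: complex)" for k
  let ?S = "su2 p p' 0 1"
  have S: "?S $ i $ k = (if k = t i then c i else 0)" for i k
    using assms by (auto simp: su2_def t_def c_def)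
  have 1: "(?S ** skew p q z) $ i $ k = c i * skew p q z $ t i $ k" for i k
    unfolding matrix_mult_nth by (subst sum_eq_one[of "t i"]) (auto simp: S)
  have 2: "(?S ** skew p q z ** dagger ?S) $ i $ j = c i * skew p q z $ t i $ t j * cnj (c j)" for i j
    unfolding matrix_mult_nth[of "?S ** skew p q z"] 1
    by (subst sum_eq_one[of "t j"]) (auto simp: S)
  show ?thesis
    by (rule cmat_eqI, unfold 2) (use assms in \<open>auto simp: c_def t_def skew_def\<close>)
qed

text \<open>The root planes for A-B, A-C and B-C span \<open>mspace\<close>. \<open>f False\<close>,
  \<open>f True\<close> and \<open>g\<close> collect the three parts of \<open>X\<close>, and
  additivity does the rest.\<close>

lemma invariant_acs_eq_on_mspace:
  fixes K L :: "('n::finite) cmat \<Rightarrow> 'n cmat"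
  assumes K: "invariant_acs K" and L: "invariant_acs L"
    and eq: "\<And>i b z. K (skew (Inl i) (Inr b) z) = L (skew (Inl i) (Inr b) z)"
      "\<And>z. K (skew (Inr False) (Inr True) z) = L (skew (Inr False) (Inr True) z)"
    and X: "X \<in> mspace"
  shows "K X = L X"
proof -
  define f :: "bool \<Rightarrow> 'n \<Rightarrow> 'n cmat"
    where "f b i = skew (Inl i) (Inr b) (X $ Inl i $ Inr b)" for b i
  define g :: "'n cmat" where "g = skew (Inr False) (Inr True) (X $ Inr False $ Inr True)"
  have f: "f b i \<in> mspace" for b i unfolding f_def by (intro skew_mspace) auto
  have g: "g \<in> mspace" unfolding g_def by (intro skew_mspace) auto
  have entry: "X $ p $ q = sum (f False) UNIV $ p $ q + sum (f True) UNIV $ p $ q + g $ p $ q" for p q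
  proof -
    have sf: "sum (f b) UNIV $ p $ q = (case p of
        Inl i \<Rightarrow> if q = Inr b then X $ p $ q else 0
      | Inr b' \<Rightarrow> if b' = b \<and> isl q then - cnj (X $ q $ p) else 0)" for b
    proof (cases p)
      case (Inl i)
      have "sum (f b) UNIV $ p $ q = (\<Sum>k\<in>UNIV. f b k $ p $ q)" by (simp)
      also have "\<dots> = f b i $ p $ q"
        by (rule sum_eq_one) (auto simp: f_def skew_def Inl)
      finally show ?thesis using Inl by (auto simp: f_def skew_def)
    next
      case (Inr b')
      show ?thesis
      proof (cases q)
        case (Inl i)
        have "sum (f b) UNIV $ p $ q = (\<Sum>k\<in>UNIV. f b k $ p $ q)" by (simp)
        also have "\<dots> = f b i $ p $ q"
          by (rule sum_eq_one) (auto simp: f_def skew_def Inl)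
        finally show ?thesis using Inl Inr by (auto simp: f_def skew_def)
      next
        case (Inr b'')
        then show ?thesis using \<open>p = Inr b'\<close> by (simp add: f_def skew_def)
      qed
    qed
    show ?thesis
      unfolding sf g_def using mspace_block[OF X] mspace_skew_sym[OF X, of q p]
      by (cases p rule: index_cases; cases q rule: index_cases)
         (auto simp: skew_def)
  qed
  have X_eq: "X = sum (f False) UNIV + sum (f True) UNIV + g"
    by (rule cmat_eqI) (simp only: vector_add_component entry)
  have "M X = (\<Sum>i\<in>UNIV. M (f False i)) + (\<Sum>i\<in>UNIV. M (f True i)) + M g"
    if M: "invariant_acs M" for M
    unfolding X_eq using invariant_acs_sum[OF M, of UNIV "f False"] invariant_acs_sum[OF M, of UNIV "f True"]
      f g by (simp add: invariant_acs_add[OF M] mspace_add)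
  from this[OF K] this[OF L] show ?thesis
    by (simp add: f_def g_def eq)
qed

lemma invariant_acs_classification:
  fixes K :: "('n::finite) cmat \<Rightarrow> 'n cmat"
  assumes K: "invariant_acs K"
  shows "\<exists>a\<in>{1, -1}. \<exists>b\<in>{1, -1}. \<exists>c\<in>{1, -1}. \<forall>X\<in>mspace. K X = sign_acs a b c X"
proof -
  have "\<exists>s\<in>{1, -1}. \<forall>i z. K (skew (Inl i) (Inr b) z) = skew (Inl i) (Inr b) (\<i> * of_real s * z)" for b
  proof -
    have "\<forall>i. \<exists>s\<in>{1, -1 :: real}. \<forall>z. K (skew (Inl i) (Inr b) z)
        = skew (Inl i) (Inr b) (\<i> * of_real s * z)"
      using invariant_acs_skew[OF K] by simp
    then obtain s where s: "\<And>i. s i \<in> {1, -1 :: real}"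
      "\<And>i z. K (skew (Inl i) (Inr b) z) = skew (Inl i) (Inr b) (\<i> * of_real (s i) * z)"
      by metis
    have "s i = s j" for i j
    proof (cases "i = j")
      case False
      \<comment> \<open>Both indices lie in block A, so this signed transposition belongs to
        \<open>SUH\<close>. The factor -1 that it introduces appears on both sides of the comparison
        and cancels.\<close>
      let ?S = "su2 (Inl i) (Inl j) 0 1 :: 'n cmat"
      have S: "?S \<in> SUH"
        using False su2_SU[of "Inl i" "Inl j" 0 1] by (auto simp: SUH_def su2_def same_block_def)
      have m: "skew (Inl i) (Inr b) 1 \<in> (mspace :: 'n cmat set)" by (intro skew_mspace) auto
      have c: "?S ** skew (Inl i) (Inr b) z ** dagger ?S = skew (Inl j) (Inr b) (- z)" for z
        using False by (intro su2_conj_skew) auto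
      have "skew (Inl j) (Inr b) (\<i> * of_real (s j) * (- 1))
          = (skew (Inl j) (Inr b) (- (\<i> * of_real (s i) * 1)) :: 'n cmat)"
        using invariant_acs_SUH[OF K S m] by (simp only: c s(2))
      from arg_cong[OF this, of "\<lambda>A. A $ Inl j $ Inr b"] show ?thesis
        by (simp add: skew_def)
    qed simp
    \<comment> \<open>\<open>undefined\<close> is an arbitrary reference index of \<open>'n\<close>;
      its sign serves for all.\<close>
    then have "s i = s undefined" for i by blast
    then show ?thesis using s by metis
  qed
  then obtain s where s: "\<And>b. s b \<in> {1, -1 :: real}"
    "\<And>b i z. K (skew (Inl i) (Inr b) z) = skew (Inl i) (Inr b) (\<i> * of_real (s b) * z)"
    by metis
  have nb: "\<not> same_block (Inr False :: 'n + bool) (Inr True)" by simp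
  obtain c where c: "c \<in> {1, -1 :: real}"
    "\<And>z. K (skew (Inr False) (Inr True) z) = skew (Inr False) (Inr True) (\<i> * of_real c * z)"
    using invariant_acs_skew[OF K nb] by blast
  have "K X = sign_acs (s False) (s True) c X" if "X \<in> mspace" for X
  proof (rule invariant_acs_eq_on_mspace[OF K invariant_sign_acs])
    show "K (skew (Inl i) (Inr b) z) = sign_acs (s False) (s True) c (skew (Inl i) (Inr b) z)" for i b z
      by (cases b) (simp_all add: sign_acs_skew s(2))
  qed (use s c that in \<open>auto simp: sign_acs_skew\<close>)
  then show ?thesis using s(1) c(1) by blast
qed

section \<open>The automorphism exchanging the last two coordinates\<close>

definition swap_index :: "'n + bool \<Rightarrow> 'n + bool" where
  "swap_index i = (case i of Inl a \<Rightarrow> Inl a | Inr b \<Rightarrow> Inr (\<not> b))"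

text \<open>This is conjugation by the permutation matrix of B and C. That matrix has determinant -1
  and is not in \<open>SU\<close>, but conjugation by it preserves \<open>SU\<close> and
  \<open>SUH\<close>. Being linear on matrices, the automorphism is its own derivative.\<close>

definition swap_last :: "('n::finite) cmat \<Rightarrow> 'n cmat" where
  "swap_last A = (\<chi> i j. A $ swap_index i $ swap_index j)"

lemma swap_index_idem [simp]: "swap_index (swap_index i) = i"
  by (simp add: swap_index_def split: sum.splits)

lemma bij_swap_index: "bij swap_index"
  by (rule involuntory_imp_bij) simp

lemma same_block_swap_index [simp]: "same_block (swap_index i) (swap_index j) = same_block i j"
  by (cases i; cases j) (auto simp: swap_index_def)

lemma swap_last_nth [simp]: "swap_last A $ i $ j = A $ swap_index i $ swap_index j"
  by (simp add: swap_last_def)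

lemma swap_last_idem [simp]: "swap_last (swap_last A) = A"
  by (rule cmat_eqI) simp

lemma swap_last_mult: "swap_last (A ** B) = swap_last A ** swap_last B"
proof (rule cmat_eqI)
  fix i j
  show "swap_last (A ** B) $ i $ j = (swap_last A ** swap_last B) $ i $ j"
    using sum.reindex_bij_betw[OF bij_swap_index,
        of "\<lambda>k. A $ swap_index i $ k * B $ k $ swap_index j"]
    by (simp add: matrix_mult_nth)
qed

text \<open>Rows and columns undergo the same permutation, so its sign occurs squared.\<close>

lemma det_swap_last: "det (swap_last A) = det (A :: ('n::finite) cmat)"
proof -
  let ?p = "swap_index :: 'n + bool \<Rightarrow> _"
  have p: "?p permutes UNIV" by (rule bij_imp_permutes) (auto simp: bij_swap_index)
  have "swap_last A = (\<chi> i. (\<chi> j. \<chi> k. A $ j $ ?p k) $ ?p i)"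
    by (rule cmat_eqI) simp
  then have "det (swap_last A) = of_int (sign ?p) * (of_int (sign ?p) * det A)"
    using det_permute_rows[OF p, of "\<chi> j k. A $ j $ ?p k"] det_permute_columns[OF p, of A] by simp
  also have "\<dots> = det A"
    by (simp add: mult.assoc[symmetric] of_int_mult[symmetric] sign_idempotent del: of_int_mult)
  finally show ?thesis .
qed

lemma swap_last_SU: "g \<in> SU \<Longrightarrow> swap_last g \<in> SU"
proof -
  assume g: "g \<in> SU"
  have "dagger (swap_last g) = swap_last (dagger g)" by (rule cmat_eqI) simp
  then have "swap_last g ** dagger (swap_last g) = swap_last (mat 1)"
    using g by (simp add: swap_last_mult[symmetric] SU_right)
  also have "\<dots> = mat 1" by (rule cmat_eqI) (metis mat_nth swap_index_idem swap_last_nth)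
  finally show ?thesis using g by (simp add: SU_def det_swap_last)
qed

lemma swap_last_SUH: "g \<in> SUH \<Longrightarrow> swap_last g \<in> SUH"
  by (auto simp: SUH_def swap_last_SU)

lemma swap_last_image: "(\<And>g. g \<in> A \<Longrightarrow> swap_last g \<in> A) \<Longrightarrow> swap_last ` A = A"
  by (metis image_eqI subsetI subset_antisym image_subset_iff swap_last_idem)

lemma bounded_linear_swap_last: "bounded_linear swap_last"
  by (rule linear_conv_bounded_linear[THEN iffD1], rule linearI) (simp_all add: vec_eq_iff)

lemma pair_automorphism_swap_last: "pair_automorphism swap_last"
proof -
  have "inj_on swap_last SU" by (metis inj_onI swap_last_idem)
  then show ?thesis
    by (auto simp: pair_automorphism_def bij_betw_def swap_last_mult smooth_map_on_bounded_linear
        bounded_linear_swap_last swap_last_image swap_last_SU swap_last_SUH)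
qed

lemma swap_last_mspace: "X \<in> mspace \<Longrightarrow> swap_last X \<in> mspace"
  by (simp add: mspace_iff)

lemma swap_last_sign_acs:
  "swap_last (sign_acs a b c X) = sign_acs b a (- c) (swap_last (X :: ('n::finite) cmat))"
proof (rule cmat_eqI)
  fix i j :: "'n + bool"
  have "block_sign a b c (swap_index i) (swap_index j) = block_sign b a (- c) i j"
    by (cases i rule: index_cases; cases j rule: index_cases) (auto simp: swap_index_def)
  then show "swap_last (sign_acs a b c X) $ i $ j = sign_acs b a (- c) (swap_last X) $ i $ j"
    by simp
qed

lemma equivalent_acs_same:
  assumes "\<And>X. X \<in> mspace \<Longrightarrow> K X = sign_acs a b c X"
  shows "equivalent_acs K (sign_acs a b c)"
  unfolding equivalent_acs_def
proof (intro exI conjI ballI)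
  show "pair_automorphism (\<lambda>g. g)"
    using bij_betw_id by (simp add: pair_automorphism_def smooth_map_on_bounded_linear id_def)
  show "((\<lambda>g. g) has_derivative (\<lambda>X. X)) (at (mat 1) within SU)" by simp
qed (simp add: assms sign_acs_mspace mproj_mspace)

lemma equivalent_acs_swap:
  assumes "\<And>X. X \<in> mspace \<Longrightarrow> K X = sign_acs a b c X"
  shows "equivalent_acs K (sign_acs b a (- c))"
  unfolding equivalent_acs_def
proof (intro exI conjI ballI)
  show "pair_automorphism swap_last" by (rule pair_automorphism_swap_last)
  show "(swap_last has_derivative swap_last) (at (mat 1) within SU)"
    by (rule bounded_linear_imp_has_derivative) (rule bounded_linear_swap_last)
qed (simp add: assms sign_acs_mspace mproj_mspace swap_last_sign_acs swap_last_mspace)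

text \<open>Under negation and (a, b, c) -> (b, a, -c) the eight sign triples fall into orbits of
  sizes 4, 2 and 2, represented by the three listed triples; the orbit of (1, 1, 1) is the large
  one.\<close>

lemma invariant_acs_up_to_equivalence:
  assumes "invariant_acs K"
  shows "\<exists>L\<in>{sign_acs 1 1 1, sign_acs 1 (-1) (-1), sign_acs 1 (-1) 1}.
    equivalent_acs K L \<or> equivalent_acs K (conjugate_acs L)"
proof -
  obtain a b c where *: "a \<in> {1, -1}" "b \<in> {1, -1}" "c \<in> {1, -1}"
    "\<And>X. X \<in> mspace \<Longrightarrow> K X = sign_acs a b c X"
    using invariant_acs_classification[OF assms] by blast
  have "equivalent_acs K (sign_acs a b c)" "equivalent_acs K (sign_acs b a (- c))"
    using equivalent_acs_same equivalent_acs_swap *(4) by blast+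
  with *(1-3) show ?thesis by (auto simp: conjugate_sign_acs)
qed

subsection \<open>Holomorphic charts\<close>

text \<open>Left translation sends \<open>g ** X\<close> to \<open>(dagger g0 ** g) ** X\<close>:
  the representative \<open>X\<close> in \<open>mspace\<close> stays the same, hence so do the
  conditions on \<open>K\<close>. It also commutes with right multiplication by
  \<open>SUH\<close>.\<close>

lemma holomorphic_chart_translate:
  fixes F :: "('n::finite) cmat \<Rightarrow> complex ^ ('n + 'n + unit)"
  assumes chart: "holomorphic_chart K W F" and g0: "g0 \<in> SU"
  shows "holomorphic_chart K {g \<in> SU. dagger g0 ** g \<in> W} (\<lambda>g. F (dagger g0 ** g))"
proof -
  define L :: "'n cmat \<Rightarrow> 'n cmat" where "L g = dagger g0 ** g" for g
  have bl: "bounded_linear L" unfolding L_def by (rule bounded_linear_matrix_mult_left)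
  have L_SU: "L g \<in> SU" if "g \<in> SU" for g
    using that g0 by (simp add: L_def SU_mult SU_dagger)
  have L_mult: "L (g ** h) = L g ** h" for g and h :: "'n cmat" by (simp add: L_def matrix_mul_assoc)
  have L_inj: "L g = L h \<longleftrightarrow> g = h" for g h
    unfolding L_def by (metis SU_cancel_right g0)
  let ?W = "{g \<in> SU. L g \<in> W}"
  have chart': "openin (top_of_set SU) W" "\<And>g k. g \<in> W \<Longrightarrow> k \<in> SUH \<Longrightarrow> g ** k \<in> W"
    "smooth_map_on W F"
    "\<And>g g'. g \<in> W \<Longrightarrow> g' \<in> W \<Longrightarrow> F g = F g' \<longleftrightarrow> (\<exists>k\<in>SUH. g' = g ** k)"
    "\<And>g. g \<in> W \<Longrightarrow> \<exists>D. (F has_derivative D) (at g within W) \<and>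
        (\<forall>X\<in>mspace. D (g ** K X) = \<i> *s D (g ** X)) \<and> (\<forall>X\<in>mspace. D (g ** X) = 0 \<longrightarrow> X = 0)"
    using chart unfolding holomorphic_chart_def by blast+
  have vimage: "open (L -` T)" if "open T" for T
    using that bl by (intro open_vimage linear_continuous_on)
  have "holomorphic_chart K ?W (\<lambda>g. F (L g))"
    unfolding holomorphic_chart_def
  proof (intro conjI ballI)
    obtain T where T: "open T" "W = SU \<inter> T" using chart'(1) by (auto simp: openin_open)
    have "?W = SU \<inter> L -` T" using T L_SU by auto
    then show "openin (top_of_set SU) ?W" using vimage[OF T(1)] by (auto simp: openin_open)
    show "g ** k \<in> ?W" if "g \<in> ?W" "k \<in> SUH" for g k
      using that chart'(2) by (auto simp: L_mult SU_mult SUH_SU)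
    show "smooth_map_on ?W (\<lambda>g. F (L g))"
      unfolding smooth_map_on_def
    proof
      fix x assume "x \<in> ?W"
      then obtain U G where U: "open U" "L x \<in> U" "smooth_on U G" "\<forall>y\<in>W \<inter> U. G y = F y"
        using chart'(3) unfolding smooth_map_on_def by auto
      then show "\<exists>U G. open U \<and> x \<in> U \<and> smooth_on U G \<and> (\<forall>y\<in>?W \<inter> U. G y = F (L y))"
        by (intro exI[of _ "L -` U"] exI[of _ "\<lambda>g. G (L g)"])
           (auto simp: vimage smooth_on_def intro: Ck_on_compose_linear[OF bl])
    qed
    show "(F (L g) = F (L g')) = (\<exists>k\<in>SUH. g' = g ** k)" if "g \<in> ?W" "g' \<in> ?W" for g g'
      using that chart'(4)[of "L g" "L g'"] by (simp add: L_mult[symmetric] L_inj)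
    fix g assume g: "g \<in> ?W"
    then obtain D where D: "(F has_derivative D) (at (L g) within W)"
      "\<forall>X\<in>mspace. D (L g ** K X) = \<i> *s D (L g ** X)" "\<forall>X\<in>mspace. D (L g ** X) = 0 \<longrightarrow> X = 0"
      using chart'(5)[of "L g"] by auto
    have "(F has_derivative D) (at (L g) within L ` ?W)"
      using D(1) by (rule has_derivative_subset) auto
    then have "((\<lambda>g. F (L g)) has_derivative (\<lambda>X. D (L X))) (at g within ?W)"
      by (rule has_derivative_in_compose[OF bounded_linear_imp_has_derivative[OF bl]])
    then show "\<exists>D. ((\<lambda>g. F (L g)) has_derivative D) (at g within ?W) \<and>
        (\<forall>X\<in>mspace. D (g ** K X) = \<i> *s D (g ** X)) \<and> (\<forall>X\<in>mspace. D (g ** X) = 0 \<longrightarrow> X = 0)"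
      using D by (intro exI[of _ "\<lambda>X. D (L X)"]) (simp add: L_mult)
  qed
  then show ?thesis by (simp add: L_def)
qed

lemma integrable_acs_if_chart_at_one:
  assumes "holomorphic_chart K W F" "mat 1 \<in> W"
  shows "integrable_acs K"
  unfolding integrable_acs_def
proof
  fix g :: "'a cmat" assume g: "g \<in> SU"
  then show "\<exists>W F. g \<in> W \<and> holomorphic_chart K W F"
    using holomorphic_chart_translate[OF assms(1) g] assms(2) SU_left[OF g]
    by (intro exI[of _ "{h \<in> SU. dagger g ** h \<in> W}"] exI) auto
qed

text \<open>Both charts are formulas on an open set of all matrices, so their derivatives are
  computed there without constraint. Invariance, injectivity modulo \<open>SUH\<close> and the
  conditions along \<open>g ** X\<close> are asked only at points of \<open>SU\<close>.\<close>

lemma holomorphic_chartI: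
  fixes F :: "('n::finite) cmat \<Rightarrow> complex ^ ('n + 'n + unit)"
  assumes "open U" "smooth_on U F"
    and "\<And>g k. g \<in> SU \<Longrightarrow> g \<in> U \<Longrightarrow> k \<in> SUH \<Longrightarrow> g ** k \<in> U \<and> F (g ** k) = F g"
    and "\<And>g g'. g \<in> SU \<Longrightarrow> g \<in> U \<Longrightarrow> g' \<in> SU \<Longrightarrow> g' \<in> U \<Longrightarrow> F g = F g' \<Longrightarrow> \<exists>k\<in>SUH. g' = g ** k"
    and "\<And>g. g \<in> U \<Longrightarrow> (F has_derivative D g) (at g)"
    and "\<And>g X. g \<in> SU \<Longrightarrow> g \<in> U \<Longrightarrow> X \<in> mspace \<Longrightarrow> D g (g ** K X) = \<i> *s D g (g ** X)"
    and "\<And>g X. g \<in> SU \<Longrightarrow> g \<in> U \<Longrightarrow> X \<in> mspace \<Longrightarrow> D g (g ** X) = 0 \<Longrightarrow> X = 0"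
  shows "holomorphic_chart K (SU \<inter> U) F"
  unfolding holomorphic_chart_def
proof (intro conjI ballI)
  show "openin (top_of_set SU) (SU \<inter> U)" using assms(1) by (auto simp: openin_open)
  show "g ** k \<in> SU \<inter> U" if "g \<in> SU \<inter> U" "k \<in> SUH" for g k
    using that assms(3) by (auto intro: SU_mult SUH_SU)
  show "smooth_map_on (SU \<inter> U) F" using assms(1,2) by (auto simp: smooth_map_on_def)
  show "(F g = F g') = (\<exists>k\<in>SUH. g' = g ** k)" if "g \<in> SU \<inter> U" "g' \<in> SU \<inter> U" for g g'
    using that assms(3)[of g] assms(4)[of g g'] by auto
  show "\<exists>D. (F has_derivative D) (at g within SU \<inter> U) \<and>
      (\<forall>X\<in>mspace. D (g ** K X) = \<i> *s D (g ** X)) \<and> (\<forall>X\<in>mspace. D (g ** X) = 0 \<longrightarrow> X = 0)"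
    if "g \<in> SU \<inter> U" for g
    using that assms(5-7)[of g] by (intro exI[of _ "D g"]) (auto intro: has_derivative_at_withinI)
qed

section \<open>Cosets and tangent vectors in terms of columns\<close>

lemma SUH_last_column:
  assumes "k \<in> SUH"
  shows "(u ** k) $ j $ Inr b = u $ j $ Inr b * k $ Inr b $ Inr b"
  unfolding matrix_mult_nth by (rule sum_eq_one) (use assms in \<open>auto simp: SUH_def same_block_def\<close>)

lemma SUH_last_diagonal: "k \<in> SUH \<Longrightarrow> k $ Inr b $ Inr b \<noteq> 0"
proof
  assume k: "k \<in> SUH" "k $ Inr b $ Inr b = 0"
  then have "k $ j $ Inr b = 0" for j
    using SUH_nth[OF k(1), of j "Inr b"] by (cases "j = Inr b") (auto simp: same_block_def)
  then show False
    using SU_orthonormal_columns[OF SUH_SU[OF k(1)], of "Inr b" "Inr b"] by simp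
qed

text \<open>The lines of columns B and C determine the coset, since the other columns span their
  orthogonal complement. In \<open>dagger u ** u'\<close>, orthonormality of the columns of
  \<open>u\<close> clears columns B and C off the diagonal, and that of \<open>u'\<close> clears the
  corresponding rows.\<close>

lemma SUH_if_proportional_columns:
  fixes u u' :: "('n::finite) cmat"
  assumes u: "u \<in> SU" and u': "u' \<in> SU"
    and col: "\<And>b j. u' $ j $ Inr b = c b * u $ j $ Inr b"
  shows "\<exists>k\<in>SUH. u' = u ** k"
proof
  let ?k = "dagger u ** u'"
  show "u' = u ** ?k" by (simp add: SU_cancel_right[OF u])
  have k: "?k $ p $ q = (\<Sum>j\<in>UNIV. cnj (u $ j $ p) * u' $ j $ q)" for p q
    by (simp add: matrix_mult_nth)
  have right: "?k $ p $ Inr b = 0" if "p \<noteq> Inr b" for p b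
  proof -
    have "?k $ p $ Inr b = c b * (\<Sum>j\<in>UNIV. cnj (u $ j $ p) * u $ j $ Inr b)"
      by (simp add: k col sum_distrib_left mult_ac)
    then show ?thesis using SU_orthonormal_columns[OF u] that by simp
  qed
  have left: "?k $ Inr b $ q = 0" if "q \<noteq> Inr b" for q b
  proof -
    have "c b \<noteq> 0"
      using SU_orthonormal_columns[OF u', of "Inr b" "Inr b"] by (auto simp: col)
    moreover have "cnj (c b) * ?k $ Inr b $ q = (\<Sum>j\<in>UNIV. cnj (u' $ j $ Inr b) * u' $ j $ q)"
      by (simp add: k col sum_distrib_left mult_ac)
    ultimately show ?thesis using SU_orthonormal_columns[OF u', of "Inr b" q] that by auto
  qed
  have "?k $ p $ q = 0" if "\<not> same_block p q" for p q
    using that left right by (cases p; cases q) auto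
  then show "?k \<in> SUH" using u u' by (simp add: SUH_def SU_mult SU_dagger)
qed

lemma mspace_eq_0I:
  assumes X: "X \<in> mspace"
    and 0: "\<And>i b. X $ Inl i $ Inr b = 0" "X $ Inr False $ Inr True = 0"
  shows "X = 0"
proof (rule cmat_eqI)
  fix p q
  have "\<And>i b. X $ Inr b $ Inl i = 0" "X $ Inr True $ Inr False = 0"
    using mspace_skew_sym[OF X] 0 by (metis complex_cnj_zero neg_equal_0_iff_equal)+
  then show "X $ p $ q = 0 $ p $ q"
    using 0 mspace_block[OF X]
    by (cases p rule: index_cases; cases q rule: index_cases) auto
qed

text \<open>Multiplying by \<open>dagger u\<close> reads off the coefficients. A vanishing chart
  derivative says that the velocity of a column is a combination of columns of \<open>u\<close>;
  this turns that into zeros of \<open>X\<close>.\<close>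

lemma SU_columns_eq:
  assumes u: "u \<in> SU" and V: "\<And>j. (u ** X) $ j $ q = (\<Sum>r\<in>R. c r * u $ j $ r)" and R: "finite R"
  shows "X $ k $ q = (if k \<in> R then c k else 0)"
proof -
  have "X $ k $ q = (dagger u ** (u ** X)) $ k $ q" by (simp add: SU_cancel_left[OF u])
  also have "\<dots> = (\<Sum>j\<in>UNIV. cnj (u $ j $ k) * (\<Sum>r\<in>R. c r * u $ j $ r))"
    unfolding matrix_mult_nth[of "dagger u"] V by simp
  also have "\<dots> = (\<Sum>r\<in>R. c r * (\<Sum>j\<in>UNIV. cnj (u $ j $ k) * u $ j $ r))"
    by (simp only: sum_distrib_left mult.left_commute, subst sum.swap, rule refl)
  also have "\<dots> = (\<Sum>r\<in>R. if r = k then c r else 0)"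
    unfolding SU_orthonormal_columns[OF u] by (intro sum.cong) auto
  finally show ?thesis using R by simp
qed

text \<open>The velocity of column B or C is split by blocks, since \<open>sign_acs\<close> acts on
  each part as a scalar. The diagonal term is absent because \<open>X\<close> vanishes within
  blocks.\<close>

lemma matrix_mult_column_last:
  assumes X: "X \<in> mspace"
  shows "(u ** X) $ p $ Inr b
    = (\<Sum>i\<in>UNIV. u $ p $ Inl i * X $ Inl i $ Inr b) + u $ p $ Inr (\<not> b) * X $ Inr (\<not> b) $ Inr b"
proof -
  have "(u ** X) $ p $ Inr b = (\<Sum>k\<in>range Inl \<union> range Inr. u $ p $ k * X $ k $ Inr b)"
    by (simp add: matrix_mult_nth UNIV_sum)
  also have "\<dots> = (\<Sum>k\<in>range Inl. u $ p $ k * X $ k $ Inr b) + (\<Sum>k\<in>range Inr. u $ p $ k * X $ k $ Inr b)"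
    by (rule sum.union_disjoint) auto
  also have "(\<Sum>k\<in>range Inl. u $ p $ k * X $ k $ Inr b) = (\<Sum>i\<in>UNIV. u $ p $ Inl i * X $ Inl i $ Inr b)"
    by (simp add: sum.reindex)
  also have "(\<Sum>k\<in>range Inr. u $ p $ k * X $ k $ Inr b) = (\<Sum>c\<in>UNIV. u $ p $ Inr c * X $ Inr c $ Inr b)"
    by (simp add: sum.reindex)
  also have "\<dots> = u $ p $ Inr (\<not> b) * X $ Inr (\<not> b) $ Inr b"
    using mspace_block[OF X] by (cases b) (simp_all add: UNIV_bool)
  finally show ?thesis .
qed

section \<open>The chart for \<open>sign_acs 1 (-1) (-1)\<close>\<close>

abbreviation (input) iB :: "'n + bool" where "iB \<equiv> Inr False"
abbreviation (input) iC :: "'n + bool" where "iC \<equiv> Inr True"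

text \<open>For the second structure column \<open>B\<close> spans a holomorphically varying line and column \<open>C\<close> an
  antiholomorphically varying one. Orthogonality determines the remaining coordinate
  of column \<open>C\<close>.\<close>

definition chart_J_domain :: "('n::finite) cmat set" where
  "chart_J_domain = {u. u $ iB $ iB \<noteq> 0 \<and> u $ iC $ iC \<noteq> 0}"

text \<open>The line of column B contributes n + 1 affine coordinates, the conjugated line of column
  C only n: its entry in row B is left out.\<close>

definition chart_J :: "('n::finite) cmat \<Rightarrow> complex ^ ('n + 'n + unit)" where
  "chart_J u = (\<chi> j. case j of
      Inl i \<Rightarrow> u $ Inl i $ iB / u $ iB $ iB
    | Inr (Inl i) \<Rightarrow> cnj (u $ Inl i $ iC) / cnj (u $ iC $ iC)
    | Inr (Inr _) \<Rightarrow> u $ iC $ iB / u $ iB $ iB)"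

text \<open>The differential of f / g as a function of values and velocities. The chart arguments
  rest on two properties: it is complex homogeneous in the velocities, and for nonzero
  \<open>g\<close> it vanishes exactly when the velocities are proportional to the values.\<close>

definition quotient_derivative :: "complex \<Rightarrow> complex \<Rightarrow> complex \<Rightarrow> complex \<Rightarrow> complex" where
  "quotient_derivative f g f' g' = (f' * g - f * g') / (g * g)"

lemma quotient_derivative_scale: "quotient_derivative f g (c * f') (c * g') = c * quotient_derivative f g f' g'"
  by (simp add: quotient_derivative_def algebra_simps)

lemma quotient_derivative_eq_0_iff:
  "g \<noteq> 0 \<Longrightarrow> quotient_derivative f g f' g' = 0 \<longleftrightarrow> f' = g' / g * f"
  by (simp add: quotient_derivative_def field_simps)

lemma has_derivative_quotient:
  assumes "(f has_derivative f') (at x)" "(g has_derivative g') (at x)" "g x \<noteq> 0"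
  shows "((\<lambda>x. f x / g x) has_derivative (\<lambda>v. quotient_derivative (f x) (g x) (f' v) (g' v))) (at x)"
  unfolding quotient_derivative_def by (rule has_derivative_divide'[OF assms])

definition chart_J_derivative :: "('n::finite) cmat \<Rightarrow> 'n cmat \<Rightarrow> complex ^ ('n + 'n + unit)" where
  "chart_J_derivative u V = (\<chi> j. case j of
      Inl i \<Rightarrow> quotient_derivative (u $ Inl i $ iB) (u $ iB $ iB) (V $ Inl i $ iB) (V $ iB $ iB)
    | Inr (Inl i) \<Rightarrow> quotient_derivative (cnj (u $ Inl i $ iC)) (cnj (u $ iC $ iC))
                       (cnj (V $ Inl i $ iC)) (cnj (V $ iC $ iC))
    | Inr (Inr _) \<Rightarrow> quotient_derivative (u $ iC $ iB) (u $ iB $ iB) (V $ iC $ iB) (V $ iB $ iB))"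

lemma bounded_linear_cnj_entry: "bounded_linear (\<lambda>X :: ('n::finite) cmat. cnj (X $ i $ j))"
  using bounded_linear_compose[OF bounded_linear_cnj bounded_linear_entry] .

lemmas entry_smooth =
  smooth_on_bounded_linear[OF bounded_linear_entry]
  smooth_on_bounded_linear[OF bounded_linear_cnj_entry]

lemma chart_index_cases [case_names AB AC BC]:
  fixes j :: "'n + 'n + unit"
  obtains i where "j = Inl i" | i where "j = Inr (Inl i)" | "j = Inr (Inr ())"
  by (cases j; cases "projr j") auto

lemmas entry_derivative =
  bounded_linear_imp_has_derivative[OF bounded_linear_entry]
  bounded_linear_imp_has_derivative[OF bounded_linear_cnj_entry]

text \<open>The signs at (A,B) and (C,B) are 1, those at (A,C) and (B,C) are -1. So
  \<open>sign_acs\<close> multiplies the velocity of column B by i and that of column C by -i, and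
  conjugating column C restores i.\<close>

lemma holomorphic_chart_J:
  "holomorphic_chart (sign_acs 1 (-1) (-1)) (SU \<inter> chart_J_domain) (chart_J :: ('n::finite) cmat \<Rightarrow> _)"
proof (rule holomorphic_chartI[where D = chart_J_derivative])
  have "chart_J_domain = {u :: 'n cmat. u $ iB $ iB \<noteq> 0} \<inter> {u. u $ iC $ iC \<noteq> 0}"
    by (auto simp: chart_J_domain_def)
  also have "open \<dots>"
    by (intro open_Int open_Collect_neq continuous_intros)
  finally show "open (chart_J_domain :: 'n cmat set)" .
  show "smooth_on (chart_J_domain :: 'n cmat set) chart_J"
  proof (rule smooth_on_vec)
    show "smooth_on (chart_J_domain :: 'n cmat set) (\<lambda>u. chart_J u $ j)" for j
      by (cases j rule: chart_index_cases)
         (auto simp: chart_J_def chart_J_domain_def intro!: smooth_on_divide entry_smooth)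
  qed
next
  fix g k :: "'n cmat" assume "g \<in> SU" "g \<in> chart_J_domain" "k \<in> SUH"
  then show "g ** k \<in> chart_J_domain \<and> chart_J (g ** k) = chart_J g"
    by (auto simp: chart_J_domain_def chart_J_def SUH_last_column SUH_last_diagonal vec_eq_iff
        split: sum.split)
next
  fix u u' :: "'n cmat"
  assume u: "u \<in> SU" "u \<in> chart_J_domain" and u': "u' \<in> SU" "u' \<in> chart_J_domain"
    and eq: "chart_J u = chart_J u'"
  have nz: "u $ iB $ iB \<noteq> 0" "u $ iC $ iC \<noteq> 0" "u' $ iB $ iB \<noteq> 0" "u' $ iC $ iC \<noteq> 0"
    using u u' by (auto simp: chart_J_domain_def)
  define c where "c b = u' $ Inr b $ Inr b / u $ Inr b $ Inr b" for b
  have c: "c b \<noteq> 0" for b using nz by (cases b) (auto simp: c_def)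
  have e: "chart_J u $ j = chart_J u' $ j" for j using eq by simp
  have B: "u' $ j $ iB = c False * u $ j $ iB" for j
    using e[of "Inl _"] e[of "Inr (Inr ())"] nz
    by (cases j rule: index_cases) (auto simp: chart_J_def c_def field_simps)
  have "cnj (u' $ Inl i $ iC) = cnj (c True * u $ Inl i $ iC)" for i
    using e[of "Inr (Inl i)"] nz by (simp add: chart_J_def c_def field_simps)
  then have C: "u' $ j $ iC = c True * u $ j $ iC" if "j \<noteq> iB" for j
    using that nz unfolding complex_cnj_cancel_iff
    by (cases j rule: index_cases) (auto simp: c_def)
  have split: "(\<Sum>j\<in>UNIV. f j) = f iB + (\<Sum>j\<in>- {iB}. f j)" for f :: "'n + bool \<Rightarrow> complex"
    by (simp add: sum.remove[of UNIV iB] Compl_eq_Diff_UNIV)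
  have "0 = (\<Sum>j\<in>UNIV. cnj (u' $ j $ iB) * u' $ j $ iC)"
    using SU_orthonormal_columns[OF u'(1), of iB iC] by simp
  also have "\<dots> = cnj (c False) * (cnj (u $ iB $ iB) * u' $ iB $ iC
      + c True * (\<Sum>j\<in>- {iB}. cnj (u $ j $ iB) * u $ j $ iC))"
    unfolding split by (simp add: B C sum_distrib_left algebra_simps)
  also have "(\<Sum>j\<in>- {iB}. cnj (u $ j $ iB) * u $ j $ iC) = - cnj (u $ iB $ iB) * u $ iB $ iC"
    using SU_orthonormal_columns[OF u(1), of iB iC] unfolding split
    by (simp add: eq_neg_iff_add_eq_0 add.commute)
  finally have "u' $ iB $ iC = c True * u $ iB $ iC"
    using c[of False] nz by (simp add: algebra_simps)
  with C have C': "u' $ j $ iC = c True * u $ j $ iC" for j by (cases "j = iB") auto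
  have "u' $ j $ Inr b = c b * u $ j $ Inr b" for b j
    by (cases b) (simp_all add: B C')
  then show "\<exists>k\<in>SUH. u' = u ** k" by (rule SUH_if_proportional_columns[OF u(1) u'(1)])
next
  fix u :: "'n cmat" assume u: "u \<in> chart_J_domain"
  show "(chart_J has_derivative chart_J_derivative u) (at u)"
  proof (rule has_derivative_vec)
    fix j
    show "((\<lambda>x. chart_J x $ j) has_derivative (\<lambda>v. chart_J_derivative u v $ j)) (at u)"
      using u unfolding chart_J_def chart_J_derivative_def chart_J_domain_def
      by (cases j rule: chart_index_cases)
         (auto intro!: has_derivative_quotient entry_derivative)
  qed
next
  fix u X :: "'n cmat" assume u: "u \<in> SU" "u \<in> chart_J_domain" and X: "X \<in> mspace"
  let ?K = "sign_acs 1 (-1) (-1) :: 'n cmat \<Rightarrow> 'n cmat"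
  have KX: "?K X \<in> mspace" using X by (rule sign_acs_mspace)
  have B: "(u ** ?K X) $ p $ iB = \<i> * (u ** X) $ p $ iB" for p
    unfolding matrix_mult_column_last[OF KX] matrix_mult_column_last[OF X]
    by (simp add: sum_distrib_left algebra_simps)
  have C: "(u ** ?K X) $ p $ iC = - \<i> * (u ** X) $ p $ iC" for p
    unfolding matrix_mult_column_last[OF KX] matrix_mult_column_last[OF X]
    by (simp add: sum_distrib_left sum_negf algebra_simps)
  show "chart_J_derivative u (u ** ?K X) = \<i> *s chart_J_derivative u (u ** X)"
    unfolding vec_eq_iff chart_J_derivative_def
    by (auto simp: B C quotient_derivative_scale split: sum.split)
next
  fix u X :: "'n cmat"
  assume u: "u \<in> SU" "u \<in> chart_J_domain" and X: "X \<in> mspace"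
    and 0: "chart_J_derivative u (u ** X) = 0"
  have nz: "u $ iB $ iB \<noteq> 0" "u $ iC $ iC \<noteq> 0"
    using u by (auto simp: chart_J_domain_def)
  let ?V = "u ** X"
  define c where "c b = ?V $ Inr b $ Inr b / u $ Inr b $ Inr b" for b
  have e: "chart_J_derivative u ?V $ j = 0" for j using 0 by simp
  have "?V $ j $ iB = c False * u $ j $ iB" for j
    using e[of "Inl _"] e[of "Inr (Inr ())"] nz
    by (cases j rule: index_cases) (auto simp: chart_J_derivative_def c_def quotient_derivative_eq_0_iff)
  then have XB: "X $ k $ iB = 0" if "k \<noteq> iB" for k
    using SU_columns_eq[OF u(1), of X iB "\<lambda>_. c False" "{iB}" k] that by simp
  have "X $ iB $ iC = 0"
    using mspace_skew_sym[OF X, of iC iB] XB[of iC] by simp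
  have "cnj (?V $ Inl i $ iC) = cnj (c True * u $ Inl i $ iC)" for i
    using e[of "Inr (Inl i)"] nz by (simp add: chart_J_derivative_def c_def quotient_derivative_eq_0_iff)
  then have C: "?V $ j $ iC = c True * u $ j $ iC" if "j \<noteq> iB" for j
    using that nz unfolding complex_cnj_cancel_iff
    by (cases j rule: index_cases) (auto simp: c_def)
  \<comment> \<open>This is the infinitesimal counterpart of recovering the omitted entry: the B, C
    entry of \<open>X\<close>, zero by skew symmetry, is the inner product of column B with the
    velocity of column C. Subtracting \<open>c True\<close> times the orthogonality of columns B and
    C leaves only the term of row B.\<close>
  have "X $ iB $ iC = (dagger u ** ?V) $ iB $ iC" by (simp add: SU_cancel_left[OF u(1)])
  then have "(\<Sum>j\<in>UNIV. cnj (u $ j $ iB) * ?V $ j $ iC) = 0"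
    using \<open>X $ iB $ iC = 0\<close> by (simp add: matrix_mult_nth[of "dagger u"])
  moreover have "(\<Sum>j\<in>UNIV. cnj (u $ j $ iB) * u $ j $ iC) = 0"
    using SU_orthonormal_columns[OF u(1), of iB iC] by simp
  ultimately have "0 = (\<Sum>j\<in>UNIV. cnj (u $ j $ iB) * ?V $ j $ iC)
      - c True * (\<Sum>j\<in>UNIV. cnj (u $ j $ iB) * u $ j $ iC)" by simp
  also have "\<dots> = (\<Sum>j\<in>UNIV. cnj (u $ j $ iB) * (?V $ j $ iC - c True * u $ j $ iC))"
    by (simp add: sum_subtractf sum_distrib_left algebra_simps)
  also have "\<dots> = cnj (u $ iB $ iB) * (?V $ iB $ iC - c True * u $ iB $ iC)"
    by (rule sum_eq_one) (simp add: C)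
  finally have "?V $ iB $ iC = c True * u $ iB $ iC" using nz by simp
  with C have "?V $ j $ iC = c True * u $ j $ iC" for j by (cases "j = iB") auto
  then have XC: "X $ k $ iC = 0" if "k \<noteq> iC" for k
    using SU_columns_eq[OF u(1), of X iC "\<lambda>_. c True" "{iC}" k] that by simp
  show "X = 0"
  proof (rule mspace_eq_0I[OF X])
    show "X $ Inl i $ Inr b = 0" for i b by (cases b) (simp_all add: XB XC)
  qed (simp add: XC)
qed

section \<open>The chart for \<open>sign_acs 1 1 1\<close>\<close>

text \<open>The partial flag of the last column and the span of the last two columns varies holomorphically
  for the first structure. A point of it is given by the last column and by the minors below, which
  are the second column reduced modulo the last one.\<close>

definition minor_BC :: "('n::finite) cmat \<Rightarrow> 'n + bool \<Rightarrow> complex" where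
  "minor_BC u j = u $ j $ iB * u $ iC $ iC - u $ iC $ iB * u $ j $ iC"

definition minor_BC_derivative :: "('n::finite) cmat \<Rightarrow> 'n cmat \<Rightarrow> 'n + bool \<Rightarrow> complex" where
  "minor_BC_derivative u V j = (u $ j $ iB * V $ iC $ iC + V $ j $ iB * u $ iC $ iC)
     - (u $ iC $ iB * V $ j $ iC + V $ iC $ iB * u $ j $ iC)"

definition chart_I_domain :: "('n::finite) cmat set" where
  "chart_I_domain = {u. minor_BC u iB \<noteq> 0 \<and> u $ iC $ iC \<noteq> 0}"

text \<open>There are n + 1 affine coordinates for the line of column C, and n ratios of minors for
  the line that column B spans modulo column C.\<close>

definition chart_I :: "('n::finite) cmat \<Rightarrow> complex ^ ('n + 'n + unit)" where
  "chart_I u = (\<chi> j. case j of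
      Inl i \<Rightarrow> minor_BC u (Inl i) / minor_BC u iB
    | Inr (Inl i) \<Rightarrow> u $ Inl i $ iC / u $ iC $ iC
    | Inr (Inr _) \<Rightarrow> u $ iB $ iC / u $ iC $ iC)"

definition chart_I_derivative :: "('n::finite) cmat \<Rightarrow> 'n cmat \<Rightarrow> complex ^ ('n + 'n + unit)" where
  "chart_I_derivative u V = (\<chi> j. case j of
      Inl i \<Rightarrow> quotient_derivative (minor_BC u (Inl i)) (minor_BC u iB)
                 (minor_BC_derivative u V (Inl i)) (minor_BC_derivative u V iB)
    | Inr (Inl i) \<Rightarrow> quotient_derivative (u $ Inl i $ iC) (u $ iC $ iC) (V $ Inl i $ iC) (V $ iC $ iC)
    | Inr (Inr _) \<Rightarrow> quotient_derivative (u $ iB $ iC) (u $ iC $ iC) (V $ iB $ iC) (V $ iC $ iC))"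

lemma smooth_on_minor_BC: "smooth_on S (\<lambda>u. minor_BC u j)"
  unfolding minor_BC_def by (intro smooth_on_diff smooth_on_mult entry_smooth)

lemma has_derivative_minor_BC: "((\<lambda>u. minor_BC u j) has_derivative (\<lambda>V. minor_BC_derivative u V j)) (at u)"
  unfolding minor_BC_def minor_BC_derivative_def
  by (intro has_derivative_diff has_derivative_mult entry_derivative)

lemma minor_BC_SUH:
  assumes "k \<in> SUH"
  shows "minor_BC (g ** k) j = minor_BC g j * (k $ iB $ iB * k $ iC $ iC)"
  by (simp add: minor_BC_def SUH_last_column[OF assms] algebra_simps)

lemma holomorphic_chart_I:
  "holomorphic_chart (sign_acs 1 1 1) (SU \<inter> chart_I_domain) (chart_I :: ('n::finite) cmat \<Rightarrow> _)"
proof (rule holomorphic_chartI[where D = chart_I_derivative])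
  have "chart_I_domain = {u :: 'n cmat. minor_BC u iB \<noteq> 0} \<inter> {u. u $ iC $ iC \<noteq> 0}"
    by (auto simp: chart_I_domain_def)
  also have "open \<dots>"
    unfolding minor_BC_def by (intro open_Int open_Collect_neq continuous_intros)
  finally show "open (chart_I_domain :: 'n cmat set)" .
  show "smooth_on (chart_I_domain :: 'n cmat set) chart_I"
  proof (rule smooth_on_vec)
    show "smooth_on (chart_I_domain :: 'n cmat set) (\<lambda>u. chart_I u $ j)" for j
      by (cases j rule: chart_index_cases)
         (auto simp: chart_I_def chart_I_domain_def
           intro!: smooth_on_divide entry_smooth smooth_on_minor_BC)
  qed
next
  fix g k :: "'n cmat" assume "g \<in> SU" "g \<in> chart_I_domain" "k \<in> SUH"
  then show "g ** k \<in> chart_I_domain \<and> chart_I (g ** k) = chart_I g"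
    by (auto simp: chart_I_domain_def chart_I_def minor_BC_SUH SUH_last_column SUH_last_diagonal
        vec_eq_iff split: sum.split)
next
  fix u u' :: "'n cmat"
  assume u: "u \<in> SU" "u \<in> chart_I_domain" and u': "u' \<in> SU" "u' \<in> chart_I_domain"
    and eq: "chart_I u = chart_I u'"
  have nz: "minor_BC u iB \<noteq> 0" "u $ iC $ iC \<noteq> 0" "minor_BC u' iB \<noteq> 0" "u' $ iC $ iC \<noteq> 0"
    using u u' by (auto simp: chart_I_domain_def)
  define m where "m = u' $ iC $ iC / u $ iC $ iC"
  define n where "n = minor_BC u' iB / minor_BC u iB"
  have m: "m \<noteq> 0" using nz by (auto simp: m_def)
  have e: "chart_I u $ j = chart_I u' $ j" for j using eq by simp
  have C: "u' $ j $ iC = m * u $ j $ iC" for j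
    using e[of "Inr (Inl _)"] e[of "Inr (Inr ())"] nz
    by (cases j rule: index_cases) (auto simp: chart_I_def m_def field_simps)
  have M: "minor_BC u' j = n * minor_BC u j" for j
  proof (cases j rule: index_cases)
    case (A i)
    then show ?thesis using e[of "Inl i"] nz by (simp add: chart_I_def n_def field_simps)
  next
    case C
    then show ?thesis by (simp add: minor_BC_def)
  qed (use nz in \<open>simp add: n_def\<close>)
  \<comment> \<open>Solving the minor relation for column B of \<open>u'\<close> gives a combination
    of columns B and C of \<open>u\<close>. Orthogonality to column C of \<open>u'\<close>, a
    multiple of that of \<open>u\<close>, then removes \<open>b\<close>.\<close>
  define a where "a = n * u $ iC $ iC / u' $ iC $ iC"
  define b where "b = (u' $ iC $ iB * m - n * u $ iC $ iB) / u' $ iC $ iC"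
  have B: "u' $ j $ iB = a * u $ j $ iB + b * u $ j $ iC" for j
  proof -
    have "u' $ j $ iB * u' $ iC $ iC = minor_BC u' j + u' $ iC $ iB * u' $ j $ iC"
      by (simp add: minor_BC_def)
    also have "\<dots> = n * u $ iC $ iC * u $ j $ iB + (u' $ iC $ iB * m - n * u $ iC $ iB) * u $ j $ iC"
      unfolding M C[of j] by (simp add: minor_BC_def algebra_simps)
    finally show ?thesis using nz by (simp add: a_def b_def field_simps)
  qed
  have "0 = (\<Sum>j\<in>UNIV. cnj (u' $ j $ iC) * u' $ j $ iB)"
    using SU_orthonormal_columns[OF u'(1), of iC iB] by simp
  also have "\<dots> = cnj m * (a * (\<Sum>j\<in>UNIV. cnj (u $ j $ iC) * u $ j $ iB)
      + b * (\<Sum>j\<in>UNIV. cnj (u $ j $ iC) * u $ j $ iC))"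
    by (simp add: B C sum_distrib_left sum.distrib algebra_simps)
  also have "\<dots> = cnj m * b"
    by (simp add: SU_orthonormal_columns[OF u(1)])
  finally have "b = 0" using m by simp
  then have "u' $ j $ Inr c = (if c then m else a) * u $ j $ Inr c" for c j
    by (cases c) (simp_all add: B C)
  then show "\<exists>k\<in>SUH. u' = u ** k" by (rule SUH_if_proportional_columns[OF u(1) u'(1)])
next
  fix u :: "'n cmat" assume u: "u \<in> chart_I_domain"
  show "(chart_I has_derivative chart_I_derivative u) (at u)"
  proof (rule has_derivative_vec)
    fix j
    show "((\<lambda>x. chart_I x $ j) has_derivative (\<lambda>v. chart_I_derivative u v $ j)) (at u)"
      using u unfolding chart_I_def chart_I_derivative_def chart_I_domain_def
      by (cases j rule: chart_index_cases)
         (auto intro!: has_derivative_quotient entry_derivative has_derivative_minor_BC)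
  qed
next
  fix u X :: "'n cmat" assume u: "u \<in> SU" "u \<in> chart_I_domain" and X: "X \<in> mspace"
  let ?K = "sign_acs 1 1 1 :: 'n cmat \<Rightarrow> 'n cmat"
  have KX: "?K X \<in> mspace" using X by (rule sign_acs_mspace)
  have C: "(u ** ?K X) $ p $ iC = \<i> * (u ** X) $ p $ iC" for p
    unfolding matrix_mult_column_last[OF KX] matrix_mult_column_last[OF X]
    by (simp add: sum_distrib_left algebra_simps)
  \<comment> \<open>The signs at (A,B) and (C,B) differ, so column B alone does not vary
    holomorphically. The defect is a multiple of column C of \<open>u\<close>, and adding such a
    multiple to the velocity of column B does not change the derivative of a minor.\<close>
  have B: "(u ** ?K X) $ p $ iB = \<i> * (u ** X) $ p $ iB - 2 * \<i> * X $ iC $ iB * u $ p $ iC" for p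
    unfolding matrix_mult_column_last[OF KX] matrix_mult_column_last[OF X]
    by (simp add: sum_distrib_left algebra_simps)
  have M: "minor_BC_derivative u (u ** ?K X) j = \<i> * minor_BC_derivative u (u ** X) j" for j
    unfolding minor_BC_derivative_def B C by (simp add: algebra_simps)
  show "chart_I_derivative u (u ** ?K X) = \<i> *s chart_I_derivative u (u ** X)"
    unfolding vec_eq_iff chart_I_derivative_def
    by (auto simp: M C quotient_derivative_scale split: sum.split)
next
  fix u X :: "'n cmat"
  assume u: "u \<in> SU" "u \<in> chart_I_domain" and X: "X \<in> mspace"
    and 0: "chart_I_derivative u (u ** X) = 0"
  have nz: "minor_BC u iB \<noteq> 0" "u $ iC $ iC \<noteq> 0"
    using u by (auto simp: chart_I_domain_def)
  let ?V = "u ** X"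
  have e: "chart_I_derivative u ?V $ j = 0" for j using 0 by simp
  define m where "m = ?V $ iC $ iC / u $ iC $ iC"
  define n where "n = minor_BC_derivative u ?V iB / minor_BC u iB"
  have "?V $ j $ iC = m * u $ j $ iC" for j
    using e[of "Inr (Inl _)"] e[of "Inr (Inr ())"] nz
    by (cases j rule: index_cases)
       (auto simp: chart_I_derivative_def m_def quotient_derivative_eq_0_iff)
  then have XC: "X $ k $ iC = 0" for k
    using SU_columns_eq[OF u(1), of X iC "\<lambda>_. m" "{iC}" k] mspace_block[OF X, of k iC]
    by (cases "k = iC") simp_all
  have VC: "?V $ j $ iC = 0" for j by (simp add: matrix_mult_nth XC)
  have M: "minor_BC_derivative u ?V j = n * minor_BC u j" for j
  proof (cases j rule: index_cases)
    case (A i)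
    then show ?thesis using e[of "Inl i"] nz
      by (simp add: chart_I_derivative_def n_def quotient_derivative_eq_0_iff)
  next
    case C
    then show ?thesis by (simp add: minor_BC_def minor_BC_derivative_def)
  qed (use nz in \<open>simp add: n_def\<close>)
  \<comment> \<open>These coefficients solve the minor relation for the velocity of column B. Only
    rows in block A are read off from them; the entry at C, B is covered by \<open>XC\<close> and
    skew symmetry.\<close>
  define c where "c r = (if r = iB then n else (?V $ iC $ iB - n * u $ iC $ iB) / u $ iC $ iC)"
    for r :: "'n + bool"
  have "?V $ j $ iB = (\<Sum>r\<in>{iB, iC}. c r * u $ j $ r)" for j
  proof -
    have "?V $ j $ iB * u $ iC $ iC = minor_BC_derivative u ?V j + ?V $ iC $ iB * u $ j $ iC"
      by (simp add: minor_BC_derivative_def VC)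
    also have "\<dots> = n * u $ iC $ iC * u $ j $ iB + (?V $ iC $ iB - n * u $ iC $ iB) * u $ j $ iC"
      unfolding M by (simp add: minor_BC_def algebra_simps)
    finally show ?thesis using nz by (simp add: c_def field_simps)
  qed
  then have XB: "X $ Inl i $ iB = 0" for i
    using SU_columns_eq[OF u(1), of X iB c "{iB, iC}" "Inl i"] by simp
  show "X = 0"
  proof (rule mspace_eq_0I[OF X])
    show "X $ Inl i $ Inr b = 0" for i b by (cases b) (simp_all add: XB XC)
  qed (simp add: XC)
qed

lemma integrable_sign_acs: "integrable_acs (sign_acs 1 1 1)" "integrable_acs (sign_acs 1 (-1) (-1))"
  by (rule integrable_acs_if_chart_at_one[OF holomorphic_chart_I],
      simp add: SU_one chart_I_domain_def minor_BC_def mat_nth)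
     (rule integrable_acs_if_chart_at_one[OF holomorphic_chart_J],
      simp add: SU_one chart_J_domain_def mat_nth)

subsection \<open>Non-integrability\<close>

text \<open>A derivative within \<open>SU\<close> is determined only along directions tangent to
  \<open>SU\<close>. Composing with the curve \<open>c\<close>, which stays in \<open>SU\<close> and
  has velocity \<open>g ** skew p q z\<close> at \<open>g\<close>, reduces the comparison to
  uniqueness of derivatives on the real line.\<close>

lemma tangent_derivative_unique:
  fixes f h :: "('n::finite) cmat \<Rightarrow> 'b::real_normed_vector"
  assumes pq: "p \<noteq> q" "cmod z = 1" and g: "g \<in> SU" "g \<in> N" "open N"
    and f: "(f has_derivative A) (at g within SU \<inter> N)"
    and h: "(h has_derivative B) (at g within SU \<inter> N)"
    and eq: "\<And>x. x \<in> SU \<Longrightarrow> x \<in> N \<Longrightarrow> f x = h x"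
  shows "A (g ** skew p q z) = B (g ** skew p q z)"
proof -
  define c where "c t = g ** su2 p q (of_real (cos t)) (of_real (sin t) * z)" for t
  have c_SU: "c t \<in> SU" for t
    unfolding c_def using g pq by (intro SU_mult su2_curve_SU)
  have "su2 p q 1 0 $ i $ j = (mat 1 :: 'n cmat) $ i $ j" for i j
    using pq(1) by (cases "i = p"; cases "j = p"; cases "i = q"; cases "j = q")
      (simp_all add: su2_def mat_nth)
  then have "(su2 p q 1 0 :: 'n cmat) = mat 1" by (rule cmat_eqI)
  then have c0: "c 0 = g" by (simp add: c_def)
  have "(c has_derivative (\<lambda>t. g ** (t *\<^sub>R skew p q z))) (at 0)"
    unfolding c_def
    by (rule bounded_linear.has_derivative[OF bounded_linear_matrix_mult_left su2_curve_derivative])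
       (use pq in auto)
  then have c': "(c has_derivative (\<lambda>t. t *\<^sub>R (g ** skew p q z))) (at 0)"
    by (simp add: matrix_scaleR_right)
  have "\<forall>\<^sub>F t in at 0. c t \<in> N"
    using has_derivative_continuous[OF c'] c0 g(2,3) topological_tendstoD[of c "c 0" "at 0" N]
    by (simp add: isCont_def)
  then have "\<forall>\<^sub>F t in nhds 0. c t \<in> N"
    using c0 g(2) by (simp add: eventually_nhds_conv_at)
  then obtain S where S: "open S" "0 \<in> S" "\<And>t. t \<in> S \<Longrightarrow> c t \<in> N"
    unfolding eventually_nhds by blast
  have sub: "c ` S \<subseteq> SU \<inter> N" using S c_SU by auto
  have comp: "((\<lambda>t. k (c t)) has_derivative (\<lambda>t. C (t *\<^sub>R (g ** skew p q z)))) (at 0)"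
    if "(k has_derivative C) (at g within SU \<inter> N)" for k C :: "'n cmat \<Rightarrow> 'b"
  proof -
    have "((\<lambda>t. k (c t)) has_derivative (\<lambda>t. C (t *\<^sub>R (g ** skew p q z)))) (at 0 within S)"
      using that c0 has_derivative_subset[OF _ sub]
      by (intro has_derivative_in_compose[OF has_derivative_at_withinI[OF c']]) simp
    then show ?thesis by (simp only: at_within_open[OF S(2,1)])
  qed
  have "((\<lambda>t. f (c t)) has_derivative (\<lambda>t. B (t *\<^sub>R (g ** skew p q z)))) (at 0)"
    using comp[OF h] by (rule has_derivative_transform_within_open[OF _ S(1,2)])
      (simp add: S(3) c_SU eq)
  from has_derivative_unique[OF comp[OF f] this]
  have "A (1 *\<^sub>R (g ** skew p q z)) = B (1 *\<^sub>R (g ** skew p q z))" by (rule fun_cong)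
  then show ?thesis by simp
qed

text \<open>This is the product rule for applying \<open>G' x\<close> to the moving vector
  \<open>x ** X\<close>; the term with \<open>V ** X\<close> later produces the bracket.
  Differentiability of \<open>G'\<close> is given for each fixed vector only, so the moving vector
  is expanded in the basis.\<close>

lemma has_derivative_apply_translated:
  fixes G' :: "('n::finite) cmat \<Rightarrow> 'n cmat \<Rightarrow> 'b::euclidean_space"
  assumes U: "open U" "mat 1 \<in> U"
    and lin: "\<And>x. x \<in> U \<Longrightarrow> linear (G' x)"
    and H: "\<And>v. ((\<lambda>x. G' x v) has_derivative H v) (at (mat 1))"
  shows "((\<lambda>x. G' x (x ** X)) has_derivative (\<lambda>V. H X V + G' (mat 1) (V ** X))) (at (mat 1))"
proof -
  have sum: "G' x v = (\<Sum>b\<in>Basis. (v \<bullet> b) *\<^sub>R G' x b)" if "x \<in> U" for x v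
    using lin[OF that] by (metis (no_types, lifting) euclidean_representation linear_sum linear_scale sum.cong)
  have m: "((\<lambda>x. x ** X - X) has_derivative (\<lambda>V. V ** X)) (at (mat 1))"
    by (rule has_derivative_eq_rhs[OF has_derivative_diff[OF
          bounded_linear_imp_has_derivative[OF bounded_linear_matrix_mult_right] has_derivative_const]])
       simp
  \<comment> \<open>The argument is split as \<open>X + (x ** X - X)\<close>. The second part
    vanishes at the identity, so the terms with \<open>H b\<close> drop out.\<close>
  have "((\<lambda>x. G' x X + (\<Sum>b\<in>Basis. ((x ** X - X) \<bullet> b) *\<^sub>R G' x b)) has_derivative
      (\<lambda>V. H X V + (\<Sum>b\<in>Basis. ((mat 1 ** X - X) \<bullet> b) *\<^sub>R H b V + ((V ** X) \<bullet> b) *\<^sub>R G' (mat 1) b)))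
      (at (mat 1))"
    by (intro has_derivative_add has_derivative_sum has_derivative_scaleR has_derivative_inner_left H m)
  moreover have "(\<Sum>b\<in>Basis. ((mat 1 ** X - X) \<bullet> b) *\<^sub>R H b V + ((V ** X) \<bullet> b) *\<^sub>R G' (mat 1) b)
      = G' (mat 1) (V ** X)" for V
    by (simp add: sum[OF U(2), of "V ** X"])
  ultimately have "((\<lambda>x. G' x X + (\<Sum>b\<in>Basis. ((x ** X - X) \<bullet> b) *\<^sub>R G' x b)) has_derivative
      (\<lambda>V. H X V + G' (mat 1) (V ** X))) (at (mat 1))"
    by simp
  then show ?thesis
  proof (rule has_derivative_transform_within_open[OF _ U])
    fix x assume x: "x \<in> U"
    have "(\<Sum>b\<in>Basis. ((x ** X - X) \<bullet> b) *\<^sub>R G' x b) = G' x (x ** X - X)"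
      by (rule sum[OF x, symmetric])
    then show "G' x X + (\<Sum>b\<in>Basis. ((x ** X - X) \<bullet> b) *\<^sub>R G' x b) = G' x (x ** X)"
      using linear_diff[OF lin[OF x]] by simp
  qed
qed

text \<open>The root of \<open>p\<close>, \<open>r\<close> is the sum of the other two, and the
  bracket of the planes becomes multiplication of their complex coordinates. For the blocks A, B, C
  this places the obstruction in the plane of A and C.\<close>

lemma bracket_skew:
  assumes "p \<noteq> q" "q \<noteq> r" "p \<noteq> r"
  shows "bracket (skew p q z) (skew q r w) = skew p r (z * w)"
proof -
  have mult: "(skew s t a ** M) $ i $ j
      = (if i = s then a * M $ t $ j else if i = t then - cnj a * M $ s $ j else 0)"
    if "s \<noteq> t" for s t a M i j
  proof -
    have "(skew s t a ** M) $ i $ j = skew s t a $ i $ s * M $ s $ j + skew s t a $ i $ t * M $ t $ j"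
      unfolding matrix_mult_nth by (rule sum_eq_two[OF that]) (auto simp: skew_def)
    then show ?thesis using that by (auto simp: skew_def)
  qed
  show ?thesis
    by (rule cmat_eqI) (use assms in \<open>auto simp: bracket_def mult, auto simp: skew_def\<close>)
qed

text \<open>Write \<open>f\<^sub>X(g)\<close> for the derivative of a chart at \<open>g\<close> along \<open>g X\<close>, so that \<open>f\<^bsub>K X\<^esub> = \<i> f\<^sub>X\<close>, and
  \<open>b Y X\<close> for the derivative of \<open>f\<^sub>X\<close> along \<open>Y\<close> at the identity. Then \<open>b Y (K X) = \<i> b Y X\<close>, while
  symmetry of second derivatives makes \<open>b Y X - b X Y\<close> the derivative along \<open>[Y, X]\<close>. So the derivative
  along the Nijenhuis tensor of two root vectors \<open>X\<close> and \<open>Y\<close> vanishes.\<close>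

lemma not_integrable_sign_acs: "\<not> integrable_acs (sign_acs 1 (-1) 1 :: ('n::finite) cmat \<Rightarrow> 'n cmat)"
proof
  let ?K = "sign_acs 1 (-1) 1 :: 'n cmat \<Rightarrow> 'n cmat"
  let ?e = "mat 1 :: 'n cmat"
  assume "integrable_acs ?K"
  then obtain W F where W: "?e \<in> W" and chart: "holomorphic_chart ?K W F"
    using SU_one unfolding integrable_acs_def by blast
  have open_W: "openin (top_of_set SU) W" and smooth: "smooth_map_on W F"
    using chart by (simp_all add: holomorphic_chart_def)
  have hol: "\<exists>D. (F has_derivative D) (at g within W) \<and>
      (\<forall>X\<in>mspace. D (g ** ?K X) = \<i> *s D (g ** X)) \<and> (\<forall>X\<in>mspace. D (g ** X) = 0 \<longrightarrow> X = 0)"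
    if "g \<in> W" for g
    using chart that by (simp add: holomorphic_chart_def)
  obtain T where T: "open T" "W = SU \<inter> T" using open_W by (auto simp: openin_open)
  obtain U G where U: "open U" "?e \<in> U" "smooth_on U G" "\<And>g. g \<in> W \<inter> U \<Longrightarrow> G g = F g"
    using bspec[OF smooth[unfolded smooth_map_on_def] W] by auto
  define N where "N = T \<inter> U"
  have N: "open N" "?e \<in> N" using T U W by (auto simp: N_def)
  have "Ck_on (Suc (Suc 0)) U G" using U(3) by (simp only: smooth_on_def)
  then obtain G' where G': "\<And>x. x \<in> U \<Longrightarrow> (G has_derivative G' x) (at x)"
    "\<And>v. Ck_on (Suc 0) U (\<lambda>x. G' x v)"
    unfolding Ck_on.simps(2)[of "Suc 0"] by blast
  have "\<exists>H. ((\<lambda>x. G' x v) has_derivative H) (at ?e)" for v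
    using G'(2)[of v] U(2) by auto
  then obtain H where H: "\<And>v. ((\<lambda>x. G' x v) has_derivative H v) (at ?e)" by metis
  have lin: "linear (G' x)" if "x \<in> U" for x
    using G'(1)[OF that] has_derivative_linear by blast

  have tangent: "G' g (g ** skew p q z) = D (g ** skew p q z)"
    if "g \<in> SU" "g \<in> N" "(F has_derivative D) (at g within W)" "p \<noteq> q" "cmod z = 1" for g D p q z
  proof (rule tangent_derivative_unique[OF that(4,5,1,2) N(1)])
    show "(G has_derivative G' g) (at g within SU \<inter> N)"
      using G'(1) that(2) by (auto simp: N_def intro: has_derivative_at_withinI)
    show "(F has_derivative D) (at g within SU \<inter> N)"
      using that(3) by (rule has_derivative_subset) (auto simp: N_def T)
    show "G x = F x" if "x \<in> SU" "x \<in> N" for x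
      using that U(4) by (simp add: N_def T)
  qed
  have linear_K: "G' g (g ** ?K (skew p q z)) = \<i> *s G' g (g ** skew p q z)"
    if g: "g \<in> SU" "g \<in> N" and pq: "\<not> same_block p q" "cmod z = 1" for g p q z
  proof -
    obtain D where D: "(F has_derivative D) (at g within W)"
      "\<forall>X\<in>mspace. D (g ** ?K X) = \<i> *s D (g ** X)"
      using hol[of g] g by (auto simp: N_def T)
    have ne: "p \<noteq> q" using pq by auto
    \<comment> \<open>The test curves have unit coordinates, so the coordinate of the image under
      \<open>?K\<close> must again have modulus 1.\<close>
    have "cmod (\<i> * of_real (block_sign 1 (-1) 1 p q) * z) = 1"
      using block_sign_cases[of p q 1 "-1" 1] pq by (auto simp: norm_mult)
    then show ?thesis
      using D(2) skew_mspace[OF pq(1)] tangent[OF g D(1) ne] pq(2)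
      by (simp only: sign_acs_skew) (metis sign_acs_skew)
  qed
  define b where "b Y X = H X Y + G' ?e (Y ** X)" for Y X
  have b: "((\<lambda>x. G' x (x ** X)) has_derivative (\<lambda>Y. b Y X)) (at ?e)" for X
    unfolding b_def by (rule has_derivative_apply_translated[OF U(1,2) lin H])
  have b_K: "b (skew r s w) (?K (skew p q z)) = \<i> *s b (skew r s w) (skew p q z)"
    if "\<not> same_block p q" "cmod z = 1" "r \<noteq> s" "cmod w = 1" for p q z r s w
  proof -
    have "b (?e ** skew r s w) (?K (skew p q z)) = \<i> *s b (?e ** skew r s w) (skew p q z)"
    proof (rule tangent_derivative_unique[OF that(3,4) SU_one N(2,1)])
      show "((\<lambda>x. G' x (x ** ?K (skew p q z))) has_derivative (\<lambda>Y. b Y (?K (skew p q z))))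
          (at ?e within SU \<inter> N)"
        by (rule has_derivative_at_withinI[OF b])
      have "bounded_linear (\<lambda>v :: complex ^ ('n + 'n + unit). \<i> *s v)"
        by (rule linear_conv_bounded_linear[THEN iffD1], rule linearI)
           (simp_all add: vec_eq_iff algebra_simps)
      from bounded_linear.has_derivative[OF this has_derivative_at_withinI[OF b]]
      show "((\<lambda>x. \<i> *s G' x (x ** skew p q z)) has_derivative (\<lambda>Y. \<i> *s b Y (skew p q z)))
          (at ?e within SU \<inter> N)" .
    qed (use linear_K that in blast)
    then show ?thesis by simp
  qed
  have b_bracket: "b Y X - b X Y = G' ?e (bracket Y X)" for X Y
    using second_derivative_symmetric[OF U(1,2) G'(1) H[of X] H[of Y]] lin[OF U(2)]
    by (simp add: b_def bracket_def linear_diff)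

  define a :: "'n + bool" where "a = Inl undefined"
  have ne: "\<not> same_block a iB" "\<not> same_block a iC" "\<not> same_block iB (iC :: 'n + bool)"
    "a \<noteq> iB" "a \<noteq> iC" "iB \<noteq> (iC :: 'n + bool)"
    by (simp_all add: a_def)
  define X where "X z = skew a iB z" for z
  define Y where "Y z = (skew iB iC z :: 'n cmat)" for z
  define Z where "Z z = skew a iC z" for z
  \<comment> \<open>The minus sign on \<open>Z\<close> is where the cyclic orientation enters:
    \<open>?K\<close> is i on the planes A-B and B-C, but -i on the plane of the sum of their
    roots.\<close>
  have K: "?K (X 1) = X \<i>" "?K (Y 1) = Y \<i>" "?K (Z 1) = - Z \<i>"
    by (simp_all add: X_def Y_def Z_def sign_acs_skew a_def skew_minus)
  have br: "bracket (X z) (Y w) = Z (z * w)" "bracket (Y w) (X z) = - Z (z * w)" for z w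
    using bracket_skew[OF ne(4,6,5), of z w] by (auto simp: X_def Y_def Z_def bracket_def algebra_simps)
  have "G' ?e (Z 1) $ j = 0" for j
  proof -
    have b1: "b (X \<i>) (Y \<i>) $ j = \<i> * b (X \<i>) (Y 1) $ j"
      "b (X 1) (Y \<i>) $ j = \<i> * b (X 1) (Y 1) $ j"
      "b (Y \<i>) (X \<i>) $ j = \<i> * b (Y \<i>) (X 1) $ j"
      "b (Y 1) (X \<i>) $ j = \<i> * b (Y 1) (X 1) $ j"
      using b_K[OF ne(3) _ ne(4), of 1] b_K[OF ne(1) _ ne(6), of 1] K
      by (simp_all add: X_def Y_def)
    have neg: "G' ?e (- V) $ j = - G' ?e V $ j" for V
      using lin[OF U(2)] by (simp add: linear_neg)
    have sub: "b (X z) (Y w) $ j = b (Y w) (X z) $ j + G' ?e (Z (z * w)) $ j" for z w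
      using arg_cong[OF b_bracket[of "X z" "Y w"], of "\<lambda>v. v $ j"] by (simp add: br algebra_simps)
    have "Z (- 1) = - Z 1" by (simp add: Z_def skew_minus)
    then have LZ: "G' ?e (Z (- 1)) $ j = - G' ?e (Z 1) $ j" by (simp only: neg)
    have 1: "b (Y \<i>) (X \<i>) $ j - G' ?e (Z 1) $ j = \<i> * (b (Y 1) (X \<i>) $ j + G' ?e (Z \<i>) $ j)"
      using sub[of \<i> \<i>] sub[of \<i> 1] b1(1) LZ by simp
    have 2: "b (Y \<i>) (X 1) $ j + G' ?e (Z \<i>) $ j = \<i> * (b (Y 1) (X 1) $ j + G' ?e (Z 1) $ j)"
      using sub[of 1 \<i>] sub[of 1 1] b1(2) by simp
    have "G' ?e (- Z \<i>) $ j = \<i> * G' ?e (Z 1) $ j"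
      using linear_K[OF SU_one N(2) ne(2), of 1] K(3) by (simp add: Z_def)
    then have 3: "G' ?e (Z \<i>) $ j = - \<i> * G' ?e (Z 1) $ j" using neg[of "Z \<i>"]
      by (metis minus_mult_left neg_equal_iff_equal minus_minus)
    have 4: "b (Y \<i>) (X 1) $ j = \<i> * b (Y 1) (X 1) $ j + 2 * \<i> * G' ?e (Z 1) $ j"
      using 2 unfolding 3 by (simp add: algebra_simps)
    \<comment> \<open>With g the component of \<open>G' ?e (Z 1)\<close> and \<beta> that of
      \<open>b (Y 1) (X 1)\<close>, the two sides become -\<beta> - 3 g and -\<beta> + g, so 4 g =
      0. With the opposite sign on \<open>Z\<close> both sides would agree identically.\<close>
    show ?thesis
      using 1 unfolding b1(3,4) 3 4 by (simp add: algebra_simps)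
  qed
  then have "G' ?e (?e ** Z 1) = 0" by (simp add: vec_eq_iff)
  moreover obtain D where D: "(F has_derivative D) (at ?e within W)"
    "\<forall>X\<in>mspace. D (?e ** X) = 0 \<longrightarrow> X = 0"
    using hol[OF W] by blast
  ultimately have "Z 1 = 0"
    using tangent[OF SU_one N(2) D(1) ne(5), of 1] skew_mspace[OF ne(2), of 1] by (simp add: Z_def)
  then have "Z 1 $ a $ iC = 0" by simp
  then show False by (simp add: Z_def skew_def)
qed

section \<open>The root lists in the coordinates x, y, y_i\<close>

lemma block_sign_eq_1_iff:
  "block_sign 1 1 1 p q = 1 \<longleftrightarrow>
    (\<exists>i. p = Inl i \<and> q = iB) \<or> (\<exists>i. p = Inl i \<and> q = iC) \<or> p = iB \<and> q = iC"
  "block_sign 1 (-1) (-1) p q = 1 \<longleftrightarrow>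
    (\<exists>i. p = Inl i \<and> q = iB) \<or> (\<exists>i. p = iC \<and> q = Inl i) \<or> p = iC \<and> q = iB"
  "block_sign 1 (-1) 1 p q = 1 \<longleftrightarrow>
    (\<exists>i. p = Inl i \<and> q = iB) \<or> (\<exists>i. p = iC \<and> q = Inl i) \<or> p = iB \<and> q = iC"
  by (cases p rule: index_cases; cases q rule: index_cases; auto)+

theorem proposition2:
  fixes x y :: "('n::finite) cmat \<Rightarrow> real"
    and ys :: "'n \<Rightarrow> 'n cmat \<Rightarrow> real"
    and n :: real
  assumes n: "n = real CARD('n)"
    and x_i: "\<And>i h. h \<in> torus_algebra \<Longrightarrow> xcoord (Inl i) h = ys i h + 1 / n * x h"
    and x_n1: "\<And>h. h \<in> torus_algebra \<Longrightarrow> xcoord (Inr False) h = - x h + y h"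
    and x_n2: "\<And>h. h \<in> torus_algebra \<Longrightarrow> xcoord (Inr True) h = - y h"
    and ys_sum: "\<And>h. h \<in> torus_algebra \<Longrightarrow> (\<Sum>i\<in>UNIV. ys i h) = 0"
  shows "\<exists>I J J' :: 'n cmat \<Rightarrow> 'n cmat.
      invariant_acs I \<and> invariant_acs J \<and> invariant_acs J' \<and>
      acs_roots I =
          range (\<lambda>i. \<lambda>h\<in>torus_algebra. ys i h + (n + 1) / n * x h - y h)
        \<union> range (\<lambda>i. \<lambda>h\<in>torus_algebra. ys i h + 1 / n * x h + y h)
        \<union> {\<lambda>h\<in>torus_algebra. - x h + 2 * y h} \<and>
      acs_roots J =
          range (\<lambda>i. \<lambda>h\<in>torus_algebra. ys i h + (n + 1) / n * x h - y h)
        \<union> range (\<lambda>i. \<lambda>h\<in>torus_algebra. - ys i h - 1 / n * x h - y h)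
        \<union> {\<lambda>h\<in>torus_algebra. x h - 2 * y h} \<and>
      acs_roots J' =
          range (\<lambda>i. \<lambda>h\<in>torus_algebra. ys i h + (n + 1) / n * x h - y h)
        \<union> range (\<lambda>i. \<lambda>h\<in>torus_algebra. - ys i h - 1 / n * x h - y h)
        \<union> {\<lambda>h\<in>torus_algebra. - x h + 2 * y h} \<and>
      (\<forall>K. invariant_acs K \<longrightarrow>
         (\<exists>L\<in>{I, J, J'}. equivalent_acs K L \<or> equivalent_acs K (conjugate_acs L))) \<and>
      integrable_acs I \<and> integrable_acs J \<and> \<not> integrable_acs J'"
proof -
  have "n > 0" using n by simp
  \<comment> \<open>In x_i - x_(n+1) the coefficient of x is 1 / n from x_i plus 1 from the term -x
    of x_(n+1).\<close>
  then have x: "(n + 1) / n * x h = x h + 1 / n * x h" for h by (simp add: field_simps)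
  have AB: "root_form (Inl i) iB = (\<lambda>h\<in>torus_algebra. ys i h + (n + 1) / n * x h - y h)"
    and AC: "root_form (Inl i) iC = (\<lambda>h\<in>torus_algebra. ys i h + 1 / n * x h + y h)"
    and CA: "root_form iC (Inl i) = (\<lambda>h\<in>torus_algebra. - ys i h - 1 / n * x h - y h)" for i
    unfolding root_form_def x by (auto simp: x_i x_n1 x_n2 intro!: restrict_ext)
  have BC: "root_form iB iC = (\<lambda>h\<in>torus_algebra. - x h + 2 * y h)"
    and CB: "root_form iC iB = (\<lambda>h\<in>torus_algebra. x h - 2 * y h)"
    unfolding root_form_def by (auto simp: x_n1 x_n2 intro!: restrict_ext)
  have I: "acs_roots (sign_acs 1 1 1 :: 'n cmat \<Rightarrow> 'n cmat)
      = range (\<lambda>i. root_form (Inl i) iB) \<union> range (\<lambda>i. root_form (Inl i) iC) \<union> {root_form iB iC}"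
    and J: "acs_roots (sign_acs 1 (-1) (-1) :: 'n cmat \<Rightarrow> 'n cmat)
      = range (\<lambda>i. root_form (Inl i) iB) \<union> range (\<lambda>i. root_form iC (Inl i)) \<union> {root_form iC iB}"
    and J': "acs_roots (sign_acs 1 (-1) 1 :: 'n cmat \<Rightarrow> 'n cmat)
      = range (\<lambda>i. root_form (Inl i) iB) \<union> range (\<lambda>i. root_form iC (Inl i)) \<union> {root_form iB iC}"
    unfolding acs_roots_sign_acs block_sign_eq_1_iff by blast+
  note roots = I[unfolded AB AC BC] J[unfolded AB CA CB] J'[unfolded AB CA BC]
  show ?thesis
  proof (intro exI conjI allI impI)
    show "invariant_acs (sign_acs 1 1 1 :: 'n cmat \<Rightarrow> 'n cmat)"
      "invariant_acs (sign_acs 1 (-1) (-1) :: 'n cmat \<Rightarrow> 'n cmat)"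
      "invariant_acs (sign_acs 1 (-1) 1 :: 'n cmat \<Rightarrow> 'n cmat)"
      by (rule invariant_sign_acs; simp)+
  qed (rule roots invariant_acs_up_to_equivalence integrable_sign_acs not_integrable_sign_acs; assumption?)+
qed

end
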